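(* Let $\alpha=(\alpha_1,\alpha_2,\dots,\alpha_r)$ be a composition of $n>0$. For every $w\in\mathfrak{S}_\alpha(231)$, $$\bigl(\nu_\alpha,\varphi(w)\bigr)=\mathbf{Conj}'\Bigl(\mathbf{Flip}(\nu_\alpha),\mathbf{Flip}\bigl(\Theta(w)\bigr)\Bigr).$$
   Context: Let $n>0$, $[n]=\{1,\dots,n\}$, $\alpha=(\alpha_1,\dots,\alpha_r)$ a composition of $n$. Put $s_0=0$, $s_a=\alpha_1+\cdots+\alpha_a$. The $a$-th $\alpha$-region is $\{s_{a-1}+1,\dots,s_a\}$, and $\varrho(i)$ is the index of the region containing $i$. $\mathfrak{S}_\alpha=\{w\in\mathfrak{S}_n\mid w(i)<w(i+1)\text{ whenever }\varrho(i)=\varrho(i+1)\}$; write $w_i=w(i)$. $\mathfrak{S}_\alpha(231)$ is the set of $w\in\mathfrak{S}_\alpha$ for which there are no indices $i<j<k$, each in a different $\alpha$-region, with $w_i<w_j$ and $w_i=w_k+1$. Northeast paths are lattice paths (starting on the $x$-axis, say at the origin) with steps $N=(0,1)$ and $E=(1,0)$; the length is the total number of steps. Write $[a_0,\dots,a_k]$ for $E^{a_0}NE^{a_1}N\cdots NE^{a_k}$. $\mathcal{L}_\nu$ is the set of northeast paths with the same endpoints as $\nu$ never going below $\nu$. $\nu_\alpha=N^{\alpha_1}E^{\alpha_1}\cdots N^{\alpha_r}E^{\alpha_r}$. $\mathbf{Flip}(\nu)$ is the path obtained by reversing the step word of $\nu$ and exchanging $N$ and $E$. The map $\varphi$: for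 $w\in\mathfrak{S}_\alpha$ let $\mathrm{code}_\alpha(w)=(c_1,\dots,c_n)$, where $c_i$ is the largest $k\ge0$ (with $s_{\varrho(i)}+k\le n$) such that $w_i>w_{s_{\varrho(i)}+1},\dots,w_i>w_{s_{\varrho(i)}+k}$. For $w\in\mathfrak{S}_\alpha(231)$, $\varphi(w)=[f_0,\dots,f_n]$ with $f_i=|\{j\in[n]\mid c_j+s_{\varrho(j)}=i\}|$. The map $\Theta$: for $w\in\mathfrak{S}_\alpha(231)$ build a labeled plane tree $T(w)$. Start with a root labeled $n+1$, and read $w(1),w(2),\dots,w(n)$ in order. Upon reading $w(i)$, start a walk at the root; on reaching a node $v$ with label $\ell$, if $w(i)<\ell$ move to the left-most child of $v$, otherwise move to the first sibling of $v$ on its right. When the destination node does not exist, add it (at that place) with label $w(i)$ and end the walk. Then define the northeast path $\Theta(w)$: start with $N^{k}$ where $k$ is the number of children of the root; then for $a=1,\dots,r$ and, within region $a$, for $i$ running from $s_a$ down to $s_{a-1}+1$, append $EN^{k_i}$, where $k_i$ is the number of children of the node of $T(w)$ labeled $w(i)$. It is known that $\Theta(w)\in\mathcal{L}_{\nu_\alpha}$. The map $\mathbf{Conj}'$: a Dyck path of semilength $m$ is a lattice path with $m$ steps $U=(1,1)$ and $m$ steps $D=(1,-1)$, starting and ending on the $x$-axis and never going below it. Every nonempty Dyck path $P$ decomposes uniquely as $P=P_\ell\,U\,P_r\,D$ with $P_\ell,P_r$ Dyck paths. Define recursively $\mathbf{Conj}(\epsilon)=\epsilon$ for the empty path and $\mathbf{Conj}(P_\ell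 UP_rD)=\mathbf{Conj}(P_r)\,U\,\mathbf{Conj}(P_\ell)\,D$. For a northeast path $\nu=[a_0,\dots,a_k]$ and $\mu=[b_0,\dots,b_k]\in\mathcal{L}_\nu$ put $\mathbf{Dyck}(\nu,\mu)=U^{a_0+1}D^{b_0+1}\cdots U^{a_k+1}D^{b_k+1}$; for each $m$ this is a bijection from pairs $(\nu,\mu)$, $\nu$ of length $m$ and $\mu\in\mathcal{L}_\nu$, to Dyck paths of semilength $m+1$. Finally $\mathbf{Conj}'=\mathbf{Dyck}^{-1}\circ\mathbf{Conj}\circ\mathbf{Dyck}$. *)

theory Defs
  imports Main "HOL-Combinatorics.Permutations"
begin

definition is_composition :: "nat list \<Rightarrow> nat \<Rightarrow> bool" where
  "is_composition \<alpha> n \<longleftrightarrow> sum_list \<alpha> = n \<and> (\<forall>a\<in>set \<alpha>. a > 0)"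

text \<open>The parts of \<open>\<alpha>\<close> are numbered from 1, so \<open>psum \<alpha> a\<close> is the sum of the first \<open>a\<close> parts and
  \<open>psum \<alpha> (length \<alpha>)\<close> is the number composed.\<close>

definition psum :: "nat list \<Rightarrow> nat \<Rightarrow> nat" where
  "psum \<alpha> a = sum_list (take a \<alpha>)"

definition region :: "nat list \<Rightarrow> nat \<Rightarrow> nat set" where
  "region \<alpha> a = {psum \<alpha> (a - 1) + 1 .. psum \<alpha> a}"

definition region_index :: "nat list \<Rightarrow> nat \<Rightarrow> nat" where
  "region_index \<alpha> i = (THE a. a \<in> {1..length \<alpha>} \<and> i \<in> region \<alpha> a)"

definition parabolic_perms :: "nat list \<Rightarrow> (nat \<Rightarrow> nat) set" where
  "parabolic_perms \<alpha> = {w. w permutes {1..sum_list \<alpha>} \<and>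
     (\<forall>i\<in>{1..<sum_list \<alpha>}. region_index \<alpha> i = region_index \<alpha> (i + 1) \<longrightarrow> w i < w (i + 1))}"

definition parabolic_231_avoiding :: "nat list \<Rightarrow> (nat \<Rightarrow> nat) set" where
  "parabolic_231_avoiding \<alpha> = {w \<in> parabolic_perms \<alpha>.
     \<not> (\<exists>i j k. 1 \<le> i \<and> i < j \<and> j < k \<and> k \<le> sum_list \<alpha> \<and>
        region_index \<alpha> i \<noteq> region_index \<alpha> j \<and>
        region_index \<alpha> i \<noteq> region_index \<alpha> k \<and>
        region_index \<alpha> j \<noteq> region_index \<alpha> k \<and>
        w i < w j \<and> w i = w k + 1)}"

datatype ne_step = North | East

text \<open>A path is given by its step word and starts at the origin.\<close>

type_synonym ne_path = "ne_step list"

definition ne_endpoint :: "ne_path \<Rightarrow> nat \<times> nat" where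
  "ne_endpoint \<mu> = (count_list \<mu> East, count_list \<mu> North)"

definition ne_points :: "ne_path \<Rightarrow> (nat \<times> nat) set" where
  "ne_points \<mu> = {ne_endpoint (take i \<mu>) | i. i \<le> length \<mu>}"

text \<open>A lattice point is not below \<open>\<nu>\<close> if \<open>\<nu>\<close> has a point on the same vertical line at the same
  height or lower. For paths with common endpoints it suffices to test the lattice points of
  \<open>\<mu>\<close>.\<close>

definition paths_above :: "ne_path \<Rightarrow> ne_path set" where
  "paths_above \<nu> = {\<mu>. ne_endpoint \<mu> = ne_endpoint \<nu> \<and>
     (\<forall>(x, y)\<in>ne_points \<mu>. \<exists>y'. (x, y') \<in> ne_points \<nu> \<and> y' \<le> y)}"

text \<open>\<open>path_of_runs [a\<^sub>0, \<dots>, a\<^sub>k]\<close> is the path \<open>E\<^sup>a\<^sup>0 N E\<^sup>a\<^sup>1 N \<dots> N E\<^sup>a\<^sup>k\<close>; the list must be nonempty.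
  \<open>east_runs\<close> is the inverse.\<close>

fun path_of_runs :: "nat list \<Rightarrow> ne_path" where
  "path_of_runs [] = []"
| "path_of_runs [a] = replicate a East"
| "path_of_runs (a # b # as) = replicate a East @ North # path_of_runs (b # as)"

fun east_runs :: "ne_path \<Rightarrow> nat list" where
  "east_runs [] = [0]"
| "east_runs (North # \<mu>) = 0 # east_runs \<mu>"
| "east_runs (East # \<mu>) = Suc (hd (east_runs \<mu>)) # tl (east_runs \<mu>)"

lemma east_runs_nonempty [simp]: "east_runs \<mu> \<noteq> []"
  by (induction \<mu> rule: east_runs.induct) auto

lemma path_of_runs_Suc: "path_of_runs (Suc a # as) = East # path_of_runs (a # as)"
  by (cases as) auto

lemma path_of_runs_east_runs: "path_of_runs (east_runs \<mu>) = \<mu>"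
proof (induction \<mu> rule: east_runs.induct)
  case (2 \<mu>)
  then show ?case by (cases "east_runs \<mu>") auto
next
  case (3 \<mu>)
  then show ?case by (simp add: path_of_runs_Suc)
qed simp

lemma east_runs_path_of_runs: "as \<noteq> [] \<Longrightarrow> east_runs (path_of_runs as) = as"
proof (induction as rule: path_of_runs.induct)
  case (2 a)
  then show ?case by (induction a) auto
next
  case (3 a b as)
  then show ?case by (induction a) auto
qed simp

definition nu :: "nat list \<Rightarrow> ne_path" where
  "nu \<alpha> = concat (map (\<lambda>a. replicate a North @ replicate a East) \<alpha>)"

fun swap_step :: "ne_step \<Rightarrow> ne_step" where
  "swap_step North = East"
| "swap_step East = North"

definition Flip :: "ne_path \<Rightarrow> ne_path" where
  "Flip \<nu> = map swap_step (rev \<nu>)"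

definition code_entry :: "nat list \<Rightarrow> (nat \<Rightarrow> nat) \<Rightarrow> nat \<Rightarrow> nat" where
  "code_entry \<alpha> w i = Max {k. psum \<alpha> (region_index \<alpha> i) + k \<le> sum_list \<alpha> \<and>
     (\<forall>t\<in>{1..k}. w i > w (psum \<alpha> (region_index \<alpha> i) + t))}"

definition phi :: "nat list \<Rightarrow> (nat \<Rightarrow> nat) \<Rightarrow> ne_path" where
  "phi \<alpha> w = path_of_runs (map (\<lambda>i. card {j \<in> {1..sum_list \<alpha>}.
     code_entry \<alpha> w j + psum \<alpha> (region_index \<alpha> j) = i}) [0..<sum_list \<alpha> + 1])"

datatype plane_tree = Node (label: nat) (children: "plane_tree list")

text \<open>The list is a node followed by its siblings to the right; it is empty
  if the destination of the walk does not exist.\<close>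

fun walk_insert :: "nat \<Rightarrow> plane_tree list \<Rightarrow> plane_tree list" where
  "walk_insert x [] = [Node x []]"
| "walk_insert x (Node l cs # ts) =
     (if x < l then Node l (walk_insert x cs) # ts else Node l cs # walk_insert x ts)"

definition insertion_tree :: "nat list \<Rightarrow> (nat \<Rightarrow> nat) \<Rightarrow> plane_tree" where
  "insertion_tree \<alpha> w =
     hd (fold walk_insert (map w [1..<sum_list \<alpha> + 1]) [Node (sum_list \<alpha> + 1) []])"

fun subtrees :: "plane_tree \<Rightarrow> plane_tree set" where
  "subtrees (Node l cs) = insert (Node l cs) (\<Union>t\<in>set cs. subtrees t)"

definition num_children :: "plane_tree \<Rightarrow> nat \<Rightarrow> nat" where
  "num_children T l = length (children (THE t. t \<in> subtrees T \<and> label t = l))"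

definition Theta :: "nat list \<Rightarrow> (nat \<Rightarrow> nat) \<Rightarrow> ne_path" where
  "Theta \<alpha> w = (let T = insertion_tree \<alpha> w in
     replicate (length (children T)) North @
     concat (map (\<lambda>a. concat (map (\<lambda>i. East # replicate (num_children T (w i)) North)
                                   (rev [psum \<alpha> (a - 1) + 1..<psum \<alpha> a + 1])))
                 [1..<length \<alpha> + 1]))"

datatype ud_step = Up | Down

definition height :: "ud_step list \<Rightarrow> int" where
  "height P = int (count_list P Up) - int (count_list P Down)"

definition dyck_path :: "ud_step list \<Rightarrow> bool" where
  "dyck_path P \<longleftrightarrow> height P = 0 \<and> (\<forall>i\<le>length P. height (take i P) \<ge> 0)"

lemma height_simps [simp]:
  "height [] = 0"
  "height (Up # P) = 1 + height P"
  "height (Down # P) = height P - 1"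
  "height (P @ Q) = height P + height Q"
  by (auto simp: height_def)

lemma dyck_path_Nil [simp]: "dyck_path []"
  by (simp add: dyck_path_def)

lemma dyck_path_prefix: "dyck_path (P @ Q) \<Longrightarrow> height P \<ge> 0"
  unfolding dyck_path_def by (metis append_eq_conv_conj length_append le_add1)

lemma dyck_path_iff_prefix:
  "dyck_path P \<longleftrightarrow> height P = 0 \<and> (\<forall>Q R. P = Q @ R \<longrightarrow> height Q \<ge> 0)"
  by (metis append_take_drop_id dyck_path_def dyck_path_prefix)

lemma dyck_split_aux:
  assumes "dyck_path Pl'" "dyck_path Pr" "length Pl < length Pl'" "height Pl = 0"
    and eq: "Pl @ Up # Pr @ [Down] = Pl' @ Up # Pr' @ [Down]"
  shows False
proof -
  obtain X where X: "Pl' = Pl @ X" "X @ Up # Pr' @ [Down] = Up # Pr @ [Down]"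
    using eq assms(3) by (auto simp: append_eq_append_conv2)
  with assms(3) obtain Y where Y: "X = Up # Y" by (cases X) auto
  then have "(Y @ Up # Pr') @ [Down] = Pr @ [Down]" using X(2) by simp
  then have "Pr = Y @ Up # Pr'" by simp
  then have "height Y \<ge> 0" using assms(2) dyck_path_prefix by blast
  moreover have "height Pl' = 0" using assms(1) by (simp add: dyck_path_def)
  ultimately show False using X(1) Y assms(4) by simp
qed

lemma dyck_split_unique:
  assumes "dyck_path Pl" "dyck_path Pr" "dyck_path Pl'" "dyck_path Pr'"
    and "Pl @ Up # Pr @ [Down] = Pl' @ Up # Pr' @ [Down]"
  shows "Pl = Pl' \<and> Pr = Pr'"
proof -
  have "\<not> length Pl < length Pl'" "\<not> length Pl' < length Pl"
    using dyck_split_aux[of Pl' Pr Pl Pr'] dyck_split_aux[of Pl Pr' Pl' Pr] assms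
    by (auto simp: dyck_path_def)
  then show ?thesis using assms(5) by simp
qed

lemma dyck_split_exists:
  assumes "dyck_path P" "P \<noteq> []"
  shows "\<exists>Pl Pr. dyck_path Pl \<and> dyck_path Pr \<and> P = Pl @ Up # Pr @ [Down]"
proof -
  define I where "I = {i. i < length P \<and> height (take i P) = 0}"
  have fin: "finite I" "0 \<in> I" using assms(2) by (auto simp: I_def)
  define m where "m = Max I"
  have "m \<in> I" using fin by (auto simp: m_def intro: Max_in)
  then have m: "m < length P" "height (take m P) = 0" by (auto simp: I_def)
  have pos: "height (take i P) > 0" if "m < i" "i < length P" for i
  proof -
    have "i \<notin> I" using that(1) Max_ge[OF fin(1)] by (force simp: m_def)
    then have "height (take i P) \<noteq> 0" using that(2) by (simp add: I_def)
    moreover have "height (take i P) \<ge> 0" using that(2) assms(1) by (simp add: dyck_path_def)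
    ultimately show ?thesis by simp
  qed
  have P0: "height P = 0" using assms(1) by (simp add: dyck_path_def)
  define Q where "Q = drop (Suc m) P"
  have split: "P = take m P @ P ! m # Q" using m(1) by (simp add: Q_def id_take_nth_drop)
  have "height (take (Suc m) P) \<ge> 0" using assms(1) m(1) by (simp add: dyck_path_def)
  then have up: "P ! m = Up"
    using m by (cases "P ! m") (auto simp: take_Suc_conv_app_nth)
  have "height P = height (take m P @ Up # Q)" using split up by simp
  then have hQ: "height Q = -1" using P0 m(2) by simp
  then have "Q \<noteq> []" by auto
  then obtain R s where R: "Q = R @ [s]" by (metis rev_exhaust)
  have pre: "height X \<ge> 0" if "R = X @ Y" for X Y
  proof -
    have PX: "P = (take m P @ Up # X) @ Y @ [s]" using split up R that by simp
    then have tk: "take (Suc (m + length X)) P = take m P @ Up # X"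
      using m(1) by (metis append_eq_conv_conj length_append length_Cons add_Suc_right length_take
          min.absorb4)
    have "Suc (m + length X) < length P" using arg_cong[OF PX, of length] m(1) by simp
    then have "height (take (Suc (m + length X)) P) > 0" by (intro pos) auto
    then show ?thesis using tk m(2) by simp
  qed
  have s: "s = Down" using pre[of R "[]"] hQ R by (cases s) auto
  then have "height R = 0" using hQ R by simp
  then have "dyck_path R" using pre by (auto simp: dyck_path_iff_prefix)
  moreover have "dyck_path (take m P)"
    using m assms(1) by (auto simp: dyck_path_def)
  moreover have "P = take m P @ Up # R @ [Down]" using split up R s by simp
  ultimately show ?thesis by blast
qed

definition dyck_split :: "ud_step list \<Rightarrow> ud_step list \<times> ud_step list" where
  "dyck_split P = (THE (Pl, Pr). dyck_path Pl \<and> dyck_path Pr \<and> P = Pl @ Up # Pr @ [Down])"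

lemma dyck_split_eq:
  assumes "dyck_path Pl" "dyck_path Pr"
  shows "dyck_split (Pl @ Up # Pr @ [Down]) = (Pl, Pr)"
proof -
  have "x = (Pl, Pr)" if "case x of (Ql, Qr) \<Rightarrow> dyck_path Ql \<and> dyck_path Qr \<and>
      Pl @ Up # Pr @ [Down] = Ql @ Up # Qr @ [Down]" for x
    using that dyck_split_unique[OF assms, of "fst x" "snd x"] by (simp add: case_prod_beta prod_eq_iff)
  then show ?thesis unfolding dyck_split_def by (intro the_equality) (use assms in simp_all)
qed

text \<open>\<open>Conj\<close> is only meaningful on Dyck paths; other words are sent to the empty word.\<close>

function Conj :: "ud_step list \<Rightarrow> ud_step list" where
  "Conj P = (if dyck_path P \<and> P \<noteq> [] then
               (case dyck_split P of (Pl, Pr) \<Rightarrow> Conj Pr @ Up # Conj Pl @ [Down])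
             else [])"
  by pat_completeness auto
termination
proof -
  have shorter: "length Pl < length P" "length Pr < length P"
    if P: "dyck_path P" "P \<noteq> []" and eq: "(Pl, Pr) = dyck_split P" for P Pl Pr
  proof -
    from P obtain Ql Qr where "dyck_path Ql" "dyck_path Qr" "P = Ql @ Up # Qr @ [Down]"
      using dyck_split_exists by blast
    with eq show "length Pl < length P" "length Pr < length P" by (auto simp: dyck_split_eq)
  qed
  show ?thesis
    by (relation "measure length") (auto intro: shorter)
qed

declare Conj.simps [simp del]

lemma dyck_path_join:
  assumes "dyck_path Pl" "dyck_path Pr"
  shows "dyck_path (Pl @ Up # Pr @ [Down])"
proof -
  have le: "height (take i Pl) \<ge> 0" "height (take i Pr) \<ge> 0" for i
    by (metis append_take_drop_id assms dyck_path_prefix)+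
  have "height (take i (Pl @ Up # Pr @ [Down])) \<ge> 0" for i
  proof -
    consider "i \<le> length Pl" | "i > length Pl" "i - Suc (length Pl) \<le> length Pr"
      | "i \<ge> length (Pl @ Up # Pr @ [Down])"
      by fastforce
    then show ?thesis
    proof cases
      case 2
      then obtain j where j: "i = Suc (length Pl + j)" using less_imp_Suc_add by blast
      with 2 have "j \<le> length Pr" by simp
      with j show ?thesis using le(2)[of j] assms by (simp add: dyck_path_def take_Cons')
    next
      case 1
      then show ?thesis using le(1) by simp
    next
      case 3
      then show ?thesis using assms by (simp add: dyck_path_def)
    qed
  qed
  then show ?thesis using assms by (simp add: dyck_path_def)
qed

lemma Conj_Nil: "Conj [] = []"
  by (simp add: Conj.simps)

lemma Conj_join:
  assumes "dyck_path Pl" "dyck_path Pr"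
  shows "Conj (Pl @ Up # Pr @ [Down]) = Conj Pr @ Up # Conj Pl @ [Down]"
  by (subst Conj.simps) (simp add: assms dyck_path_join dyck_split_eq)

definition path_pairs :: "(ne_path \<times> ne_path) set" where
  "path_pairs = {(\<nu>, \<mu>). \<mu> \<in> paths_above \<nu>}"

definition Dyck :: "ne_path \<times> ne_path \<Rightarrow> ud_step list" where
  "Dyck = (\<lambda>(\<nu>, \<mu>). concat (map2 (\<lambda>a b. replicate (a + 1) Up @ replicate (b + 1) Down)
                              (east_runs \<nu>) (east_runs \<mu>)))"

definition Conj' :: "ne_path \<times> ne_path \<Rightarrow> ne_path \<times> ne_path" where
  "Conj' = inv_into path_pairs Dyck \<circ> Conj \<circ> Dyck"

end

theory Submission
  imports Defs
begin

text \<open>Read a Dyck path \<open>P\<close> as a plane forest. Then \<open>Conj P\<close> is the word listing, in reverse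
  preorder, a down step for each child of a node followed by an up step for the node itself, with
  the down steps of the virtual root at the very end. So \<open>Conj (Dyck (nu \<alpha>, phi \<alpha> w))\<close> is known once
  we know the numbers of children in the forest of \<open>Dyck (nu \<alpha>, phi \<alpha> w)\<close>. That forest nests
  intervals: the interval of \<open>j\<close> opens at the end of the region of \<open>j\<close> and closes where the code entry
  of \<open>j\<close> ends. The innermost interval around a position \<open>q\<close> is the one with the least value \<open>w j\<close>.
  Since \<open>w\<close> avoids 231, this value is the smallest one exceeding \<open>w q\<close> among those to the left of \<open>q\<close>,
  which is the label of the parent of \<open>w q\<close> in the insertion tree. Hence the numbers of children are
  those recorded by \<open>Theta\<close>, up to a shift by one, and the theorem follows because \<open>Conj\<close> is an
  involution.\<close>

section \<open>Conjugation and plane forests\<close>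

text \<open>\<open>Conj\<close> exchanges the two factors of \<open>Pl @ Up # Pr @ [Down]\<close>,
  so a second application puts them back. That application of \<open>Conj_join\<close> requires the
  images of \<open>Pr\<close> and \<open>Pl\<close> to be Dyck paths, which is why both claims are
  proved together.\<close>

lemma Conj_involution:
  assumes "dyck_path P"
  shows "dyck_path (Conj P) \<and> Conj (Conj P) = P"
  using assms
proof (induction "length P" arbitrary: P rule: less_induct)
  case less
  show ?case
  proof (cases "P = []")
    case False
    then obtain Pl Pr where P: "dyck_path Pl" "dyck_path Pr" "P = Pl @ Up # Pr @ [Down]"
      using dyck_split_exists less.prems by blast
    then have "length Pl < length P" "length Pr < length P" by auto
    with less.hyps P show ?thesis by (simp add: Conj_join dyck_path_join)
  qed (simp add: Conj_Nil)
qed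

text \<open>A word describes a plane forest in preorder: \<open>Some c\<close> enters a node with \<open>c\<close> children, \<open>None\<close>
  leaves it. The stack holds, innermost node first, the numbers of children still to come; its last
  entry belongs to a virtual root.\<close>

fun parses :: "nat list \<Rightarrow> nat option list \<Rightarrow> bool" where
  "parses [0] [] = True"
| "parses (Suc r # rs) (Some c # xs) = parses (c # r # rs) xs"
| "parses (0 # r # rs) (None # xs) = parses (r # rs) xs"
| "parses _ _ = False"

definition dyck_word :: "nat option list \<Rightarrow> ud_step list" where
  "dyck_word = map (case_option Down (\<lambda>_. Up))"

text \<open>The order is reversed because \<open>Conj\<close> puts what comes from the last tree in
  front. The down steps of the virtual root are left out; \<open>parses_Conj\<close> appends
  them.\<close>

definition degree_word :: "nat option list \<Rightarrow> ud_step list" where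
  "degree_word xs = concat (rev (map (case_option [] (\<lambda>c. replicate c Down @ [Up])) xs))"

lemma dyck_word_simps [simp]:
  "dyck_word [] = []"
  "dyck_word (Some c # xs) = Up # dyck_word xs"
  "dyck_word (None # xs) = Down # dyck_word xs"
  "dyck_word (xs @ ys) = dyck_word xs @ dyck_word ys"
  "dyck_word (replicate k None) = replicate k Down"
  by (simp_all add: dyck_word_def)

lemma degree_word_simps [simp]:
  "degree_word [] = []"
  "degree_word (Some c # xs) = degree_word xs @ replicate c Down @ [Up]"
  "degree_word (None # xs) = degree_word xs"
  "degree_word (xs @ ys) = degree_word ys @ degree_word xs"
  "degree_word (replicate k None) = []"
  by (simp_all add: degree_word_def)

lemma degree_word_concat_map:
  "degree_word (concat (map F xs)) = concat (map (\<lambda>x. degree_word (F x)) (rev xs))"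
  by (induction xs) auto

lemma degree_word_map_Some:
  "degree_word (map (\<lambda>v. Some (F v)) (rev vs)) = concat (map (\<lambda>v. replicate (F v) Down @ [Up]) vs)"
  by (induction vs) auto

text \<open>\<open>ys\<close> completes the \<open>r\<close> missing subtrees of the innermost node.
  \<open>Conj\<close> splits off the last tree while parsing takes the first one, so the finished
  siblings are kept as an arbitrary Dyck prefix \<open>P\<close>: each further tree puts its degree
  word in front of \<open>Conj\<close> of the prefix and one \<open>Down\<close> behind it.\<close>

lemma parses_split:
  assumes "parses (r # rs) xs"
  shows "\<exists>ys zs. xs = ys @ zs \<and>
    (\<forall>P. dyck_path P \<longrightarrow> dyck_path (P @ dyck_word ys) \<and>
      Conj (P @ dyck_word ys) = degree_word ys @ Conj P @ replicate r Down) \<and>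
    (if rs = [] then zs = [] else \<exists>zs'. zs = None # zs' \<and> parses rs zs')"
  using assms
proof (induction "length xs" arbitrary: r rs xs rule: less_induct)
  case less
  show ?case
  proof (cases r)
    case 0
    with less.prems show ?thesis
      by (intro exI[of _ "[]"] exI[of _ xs])
        (cases "(r # rs, xs)" rule: parses.cases; auto)
  next
    case (Suc r')
    then obtain c xs' where xs: "xs = Some c # xs'" and p: "parses (c # r' # rs) xs'"
      using less.prems by (cases "(r # rs, xs)" rule: parses.cases) auto
    obtain ys zs where 1: "xs' = ys @ None # zs" "parses (r' # rs) zs"
      "\<And>P. dyck_path P \<Longrightarrow> dyck_path (P @ dyck_word ys) \<and>
        Conj (P @ dyck_word ys) = degree_word ys @ Conj P @ replicate c Down"
      using less.hyps[OF _ p] xs by auto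
    obtain ys' zs' where 2: "zs = ys' @ zs'"
      "\<And>P. dyck_path P \<Longrightarrow> dyck_path (P @ dyck_word ys') \<and>
        Conj (P @ dyck_word ys') = degree_word ys' @ Conj P @ replicate r' Down"
      "if rs = [] then zs' = [] else \<exists>us. zs' = None # us \<and> parses rs us"
      using less.hyps[OF _ 1(2)] xs 1(1) by auto
    have "dyck_path (P @ dyck_word (Some c # ys @ None # ys')) \<and>
        Conj (P @ dyck_word (Some c # ys @ None # ys')) =
        degree_word (Some c # ys @ None # ys') @ Conj P @ replicate r Down" if P: "dyck_path P" for P
    proof -
      have Y: "dyck_path (dyck_word ys)" "Conj (dyck_word ys) = degree_word ys @ replicate c Down"
        using 1(3)[of "[]"] by (auto simp: Conj_Nil)
      \<comment> \<open>The first tree, now complete, joins the prefix before its siblings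
        \<open>ys'\<close> are read.\<close>
      from 2(2)[OF dyck_path_join[OF P Y(1)]] show ?thesis
        by (simp add: Conj_join[OF P Y(1)] Y(2) Suc)
    qed
    then show ?thesis
      using 2(3) xs 1(1) 2(1)
      by (intro exI[of _ "Some c # ys @ None # ys'"] exI[of _ zs']) simp
  qed
qed

lemma parses_Conj:
  assumes "parses [m] xs"
  shows "dyck_path (dyck_word xs)" "Conj (dyck_word xs) = degree_word xs @ replicate m Down"
  using parses_split[OF assms] dyck_path_Nil by (auto simp: Conj_Nil dest!: spec[of _ "[]"])

text \<open>The new nodes form a chain ending in a leaf: each \<open>Suc\<close> pays for the next
  link, so the counters \<open>ks\<close> survive, innermost first, and the old top loses one
  child.\<close>

lemma parses_push:
  "parses (Suc r # rs) (map (\<lambda>k. Some (Suc k)) ks @ Some 0 # None # xs) =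
   parses (rev ks @ r # rs) xs"
  by (induction ks arbitrary: r rs) auto

lemma parses_pop: "parses (replicate m 0 @ r # rs) (replicate m None @ xs) = parses (r # rs) xs"
proof (induction m)
  case (Suc m)
  then show ?case by (cases m) auto
qed simp

section \<open>Runs of lattice paths\<close>

lemma map_eq_replicateI:
  assumes "\<And>x. x \<in> set xs \<Longrightarrow> f x = c" "length xs = k"
  shows "map f xs = replicate k c"
  using assms by (intro replicate_eqI) auto

lemma path_of_runs_Cons:
  "path_of_runs (a # as) = replicate a East @ concat (map (\<lambda>b. North # replicate b East) as)"
  by (induction as arbitrary: a) auto

lemma Flip_append [simp]: "Flip (\<mu> @ \<nu>) = Flip \<nu> @ Flip \<mu>"
  by (simp add: Flip_def)

lemma Flip_simps [simp]:
  "Flip [] = []"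
  "Flip (s # \<mu>) = Flip \<mu> @ [swap_step s]"
  "Flip (replicate k s) = replicate k (swap_step s)"
  by (auto simp: Flip_def)

lemma path_of_runs_append:
  assumes "bs \<noteq> []"
  shows "path_of_runs (as @ bs) = concat (map (\<lambda>a. replicate a East @ [North]) as) @ path_of_runs bs"
  using assms by (induction as rule: path_of_runs.induct) (auto simp: neq_Nil_conv)

text \<open>After the flip each \<open>East\<close> is a separating \<open>North\<close> and the
  north steps behind it are an east run; the initial block of \<open>k\<close> steps ends up
  last.\<close>

lemma Flip_north_runs:
  "Flip (replicate k North @ concat (map (\<lambda>i. East # replicate (h i) North) is)) =
   path_of_runs (rev (map h is) @ [k])"
proof -
  have "Flip (concat (map (\<lambda>i. East # replicate (h i) North) is)) =
      concat (map (\<lambda>a. replicate a East @ [North]) (rev (map h is)))"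
    by (induction "is") auto
  then show ?thesis by (simp add: path_of_runs_append)
qed

lemma Flip_nu: "Flip (nu \<alpha>) = nu (rev \<alpha>)"
  by (induction \<alpha>) (auto simp: nu_def)

definition nu_runs :: "nat list \<Rightarrow> nat list" where
  "nu_runs \<alpha> = 0 # concat (map (\<lambda>b. replicate (b - 1) 0 @ [b]) \<alpha>)"

lemma east_runs_nu:
  assumes "\<forall>a\<in>set \<alpha>. a > 0"
  shows "east_runs (nu \<alpha>) = nu_runs \<alpha>"
proof -
  have "path_of_runs (nu_runs \<alpha>) = nu \<alpha>"
    using assms
  proof (induction \<alpha>)
    case (Cons a \<alpha>)
    have "concat (replicate m [North]) = replicate m North" for m
      by (induction m) auto
    with Cons show ?case
      by (cases a) (auto simp: nu_runs_def path_of_runs_Cons nu_def replicate_append_same[symmetric])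
  qed (simp add: nu_runs_def nu_def)
  then show ?thesis
    using east_runs_path_of_runs[of "nu_runs \<alpha>"] by (simp add: nu_runs_def)
qed

lemma length_east_runs: "length (east_runs \<mu>) = Suc (count_list \<mu> North)"
  by (induction \<mu> rule: east_runs.induct) auto

section \<open>Dyck words assembled from run lists\<close>

definition dyck_of_runs :: "nat list \<Rightarrow> nat list \<Rightarrow> ud_step list" where
  "dyck_of_runs as bs =
     concat (map2 (\<lambda>a b. replicate (a + 1) Up @ replicate (b + 1) Down) as bs)"

lemma dyck_of_runs_simps [simp]:
  "dyck_of_runs [] [] = []"
  "dyck_of_runs (a # as) (b # bs) =
     Up # replicate a Up @ Down # replicate b Down @ dyck_of_runs as bs"
  by (simp_all add: dyck_of_runs_def)

lemma Dyck_eq: "Dyck (\<nu>, \<mu>) = dyck_of_runs (east_runs \<nu>) (east_runs \<mu>)"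
  by (simp add: Dyck_def dyck_of_runs_def)

lemma replicate_append_eq:
  assumes "replicate a x @ ps = replicate b x @ qs" "ps = [] \<or> hd ps \<noteq> x" "qs = [] \<or> hd qs \<noteq> x"
  shows "a = b \<and> ps = qs"
  using assms
proof (induction a arbitrary: b)
  case 0
  then show ?case by (cases b) auto
next
  case (Suc a)
  then show ?case by (cases b) auto
qed

text \<open>Thanks to the \<open>+ 1\<close> no block of equal steps is empty, so the maximal blocks
  of the word reveal the run lists.\<close>

lemma dyck_of_runs_inject:
  assumes "length as = length bs" "length as' = length bs'"
    "dyck_of_runs as bs = dyck_of_runs as' bs'"
  shows "as = as' \<and> bs = bs'"
  using assms
proof (induction as bs arbitrary: as' bs' rule: list_induct2)
  case Nil
  then show ?case by (cases as'; cases bs') auto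
next
  case (Cons a as b bs)
  then obtain a' as'' b' bs'' where eq: "as' = a' # as''" "bs' = b' # bs''"
    by (cases as'; cases bs') auto
  have hd: "dyck_of_runs xs ys = [] \<or> hd (dyck_of_runs xs ys) \<noteq> Down"
    if "length xs = length ys" for xs ys
    using that by (cases xs; cases ys) auto
  have "replicate a Up @ Down # replicate b Down @ dyck_of_runs as bs =
      replicate a' Up @ Down # replicate b' Down @ dyck_of_runs as'' bs''"
    using Cons.prems(2) by (simp add: eq)
  from replicate_append_eq[OF this] have "a = a'"
    and 2: "replicate b Down @ dyck_of_runs as bs = replicate b' Down @ dyck_of_runs as'' bs''"
    by simp_all
  have len: "length as'' = length bs''" using Cons.prems(1) by (simp add: eq)
  have "b = b'" and 3: "dyck_of_runs as bs = dyck_of_runs as'' bs''"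
    using replicate_append_eq[OF 2 hd[OF Cons.hyps] hd[OF len]] by simp_all
  with Cons.IH[OF len 3] \<open>a = a'\<close> show ?case by (simp add: eq)
qed

text \<open>Used to evaluate \<open>inv_into\<close> in \<open>Conj'\<close>. The paths of a pair
  share their endpoints, so their run lists have equal length and \<open>map2\<close> loses no
  entry.\<close>

lemma inj_on_Dyck: "inj_on Dyck path_pairs"
proof (rule inj_onI, clarify)
  fix \<nu> \<mu> \<nu>' \<mu>'
  assume *: "(\<nu>, \<mu>) \<in> path_pairs" "(\<nu>', \<mu>') \<in> path_pairs" "Dyck (\<nu>, \<mu>) = Dyck (\<nu>', \<mu>')"
  then have "length (east_runs \<nu>) = length (east_runs \<mu>)"
    "length (east_runs \<nu>') = length (east_runs \<mu>')"
    by (auto simp: length_east_runs path_pairs_def paths_above_def ne_endpoint_def)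
  with * have "east_runs \<nu> = east_runs \<nu>' \<and> east_runs \<mu> = east_runs \<mu>'"
    by (intro dyck_of_runs_inject) (auto simp: Dyck_eq)
  then show "\<nu> = \<nu>' \<and> \<mu> = \<mu>'"
    by (metis path_of_runs_east_runs)
qed

text \<open>Regroups the word into down steps followed by one \<open>Up\<close>, the shape of
  \<open>degree_word\<close>. The last group borrows its \<open>Up\<close> from the rest of the
  word.\<close>

lemma dyck_of_runs_shift:
  assumes "ks \<noteq> []" "dyck_of_runs (y # as) bs = Up # Q"
  shows "dyck_of_runs (x # replicate (length ks - 1) 0 @ y # as) (ks @ bs) =
    replicate (Suc x) Up @ concat (map (\<lambda>k. replicate (Suc k) Down @ [Up]) ks) @ Q"
  using assms(1)
proof (induction ks arbitrary: x rule: list_nonempty_induct)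
  case (single k)
  then show ?case using assms(2) by simp
next
  case (cons k ks)
  from cons.IH[of 0] show ?case using cons.hyps by (cases ks) auto
qed

text \<open>Of the \<open>b a + 1\<close> up steps after a block, one ends its last group by
  \<open>dyck_of_runs_shift\<close>, and \<open>b a\<close> are left over.\<close>

lemma dyck_of_runs_blocks:
  assumes "\<forall>a\<in>set as. length (h a) = b a \<and> b a > 0"
  shows "dyck_of_runs (x # concat (map (\<lambda>a. replicate (b a - 1) 0 @ [b a]) as))
      (concat (map h as) @ [k]) =
    replicate (Suc x) Up @
    concat (map (\<lambda>a. concat (map (\<lambda>k. replicate (Suc k) Down @ [Up]) (h a)) @ replicate (b a) Up) as) @
    replicate (Suc k) Down"
  using assms
proof (induction as arbitrary: x)
  case (Cons a as)
  from Cons.IH[of "b a"] Cons.prems dyck_of_runs_shift[of "h a" "b a" _ _ _ x] show ?case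
    by fastforce
qed simp

text \<open>The leading \<open>Up\<close> of a block is moved to the end of the block before it;
  that of the first block stays in front, and the final \<open>[Up]\<close> completes the last
  block.\<close>

lemma concat_Up_shift:
  assumes "\<forall>a\<in>set as. b a > 0"
  shows "concat (map (\<lambda>a. Up # F a @ replicate (b a - 1) Up) as) @ [Up] =
    Up # concat (map (\<lambda>a. F a @ replicate (b a) Up) as)"
  using assms
proof (induction as)
  case (Cons a as)
  then obtain m where "b a = Suc m" by (cases "b a") auto
  with Cons show ?case by (simp add: replicate_app_Cons_same)
qed simp

section \<open>Lattice points of a path in terms of its east runs\<close>

lemma ne_points_image: "ne_points \<mu> = (\<lambda>i. ne_endpoint (take i \<mu>)) ` {..length \<mu>}"
  by (auto simp: ne_points_def)

lemma ne_points_Nil: "ne_points [] = {(0, 0)}"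
  by (simp add: ne_points_image ne_endpoint_def)

lemma ne_points_Cons:
  "ne_points (s # \<mu>) = insert (0, 0)
     ((\<lambda>(x, y). case s of North \<Rightarrow> (x, Suc y) | East \<Rightarrow> (Suc x, y)) ` ne_points \<mu>)"
proof -
  have eq: "ne_endpoint (s # \<nu>) =
      (\<lambda>(x, y). case s of North \<Rightarrow> (x, Suc y) | East \<Rightarrow> (Suc x, y)) (ne_endpoint \<nu>)" for \<nu>
    by (cases s) (auto simp: ne_endpoint_def)
  show ?thesis
    unfolding ne_points_image length_Cons atMost_Suc_eq_insert_0 image_insert image_image
    by (simp add: eq ne_endpoint_def[of "[]"])
qed

lemma ne_points_bound:
  assumes "(x, y) \<in> ne_points \<mu>"
  shows "y < length (east_runs \<mu>) \<and> x \<le> sum_list (take (Suc y) (east_runs \<mu>))"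
  using assms
proof (induction \<mu> arbitrary: x y)
  case (Cons s \<mu>)
  obtain h t where ht: "east_runs \<mu> = h # t" by (cases "east_runs \<mu>") auto
  from Cons show ?case
    by (cases s) (fastforce simp: ne_points_Cons ht)+
qed (simp add: ne_points_Nil)

lemma ne_points_exists:
  assumes "x \<le> sum_list (take (Suc y) (east_runs \<mu>))"
  shows "\<exists>y'\<le>y. (x, y') \<in> ne_points \<mu>"
  using assms
proof (induction \<mu> arbitrary: x y)
  case (Cons s \<mu>)
  obtain h t where ht: "east_runs \<mu> = h # t" by (cases "east_runs \<mu>") auto
  show ?case
  proof (cases "x = 0")
    case True
    then show ?thesis by (auto simp: ne_points_Cons)
  next
    case x: False
    show ?thesis
    proof (cases s)
      case North
      with Cons.prems x obtain y0 where y: "y = Suc y0" "x \<le> sum_list (take (Suc y0) (east_runs \<mu>))"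
        by (cases y) auto
      from Cons.IH[OF y(2)] obtain y' where "y' \<le> y0" "(x, y') \<in> ne_points \<mu>" by blast
      then show ?thesis
        by (intro exI[of _ "Suc y'"]) (force simp: ne_points_Cons North y(1))
    next
      case East
      from x obtain x0 where x0: "x = Suc x0" by (cases x) auto
      with Cons.prems East have "x0 \<le> sum_list (take (Suc y) (east_runs \<mu>))" by (simp add: ht)
      from Cons.IH[OF this] show ?thesis
        by (force simp: ne_points_Cons East x0)
    qed
  qed
qed (simp add: ne_points_Nil)

lemma sum_list_east_runs: "sum_list (east_runs \<mu>) = count_list \<mu> East"
proof (induction \<mu>)
  case (Cons s \<mu>)
  obtain h t where "east_runs \<mu> = h # t" by (cases "east_runs \<mu>") auto
  with Cons show ?case by (cases s) auto
qed simp

text \<open>The partial sums are the easternmost abscissas at height \<open>y\<close>. If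
  \<open>\<mu>\<close> gets no further east than \<open>\<nu>\<close> at each height, then
  \<open>\<nu>\<close> meets the vertical line through any point of \<open>\<mu>\<close> at the same
  height or lower.\<close>

lemma paths_aboveI:
  assumes "length (east_runs \<mu>) = length (east_runs \<nu>)"
    and "sum_list (east_runs \<mu>) = sum_list (east_runs \<nu>)"
    and "\<And>y. sum_list (take (Suc y) (east_runs \<mu>)) \<le> sum_list (take (Suc y) (east_runs \<nu>))"
  shows "\<mu> \<in> paths_above \<nu>"
proof -
  have "\<exists>y'. (x, y') \<in> ne_points \<nu> \<and> y' \<le> y" if "(x, y) \<in> ne_points \<mu>" for x y
    using ne_points_bound[OF that] ne_points_exists[of x y \<nu>] assms(3)[of y] by auto
  then show ?thesis
    using assms(1,2) by (auto simp: paths_above_def ne_endpoint_def sum_list_east_runs length_east_runs)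
qed

section \<open>Insertion trees\<close>

fun forest_labels :: "plane_tree list \<Rightarrow> nat set" where
  "forest_labels [] = {}"
| "forest_labels (Node l cs # ts) = insert l (forest_labels cs \<union> forest_labels ts)"

text \<open>With first child as left son and next sibling as right son this is the binary search
  tree condition, and \<open>walk_insert\<close> is search tree insertion.\<close>

fun search_forest :: "plane_tree list \<Rightarrow> bool" where
  "search_forest [] = True"
| "search_forest (Node l cs # ts) \<longleftrightarrow> search_forest cs \<and> search_forest ts \<and>
     (\<forall>v\<in>forest_labels cs. v < l) \<and> (\<forall>v\<in>forest_labels ts. l < v)"

text \<open>An absent label yields a node without children, so its number of children is 0 before
  and right after its insertion.\<close>

fun lookup_tree :: "nat \<Rightarrow> plane_tree list \<Rightarrow> plane_tree" where
  "lookup_tree v [] = Node v []"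
| "lookup_tree v (Node l cs # ts) =
     (if v = l then Node l cs else if v < l then lookup_tree v cs else lookup_tree v ts)"

lemma label_in_forest_labels:
  assumes "t \<in> set ts" "s \<in> subtrees t"
  shows "label s \<in> forest_labels ts"
  using assms
proof (induction ts arbitrary: t rule: forest_labels.induct)
  case (2 l cs ts)
  then show ?case by (cases "t = Node l cs") auto
qed simp

lemma lookup_tree_subtree:
  assumes "search_forest ts" "t \<in> set ts" "s \<in> subtrees t"
  shows "lookup_tree (label s) ts = s"
  using assms
proof (induction ts arbitrary: t rule: search_forest.induct)
  case (2 l cs ts)
  show ?case
  proof (cases "t \<in> set ts")
    case True
    with 2 label_in_forest_labels[of t ts s] show ?thesis by fastforce
  next
    case False
    then have t: "t = Node l cs" using 2 by auto
    show ?thesis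
    proof (cases "s = Node l cs")
      case False
      with t 2(5) obtain c where c: "c \<in> set cs" "s \<in> subtrees c" by auto
      with 2 label_in_forest_labels[of c cs s] show ?thesis by fastforce
    qed simp
  qed
qed simp

lemma forest_labels_subtree:
  assumes "l \<in> forest_labels ts"
  shows "\<exists>t\<in>set ts. \<exists>s\<in>subtrees t. label s = l"
  using assms by (induction ts rule: forest_labels.induct) force+

text \<open>The search condition makes the subtree with a given label unique, so the definite
  description is found by searching.\<close>

lemma num_children_lookup:
  assumes "search_forest [T]" "l \<in> forest_labels [T]"
  shows "num_children T l = length (children (lookup_tree l [T]))"
proof -
  obtain s where s: "s \<in> subtrees T" "label s = l"
    using forest_labels_subtree[OF assms(2)] by auto
  have *: "lookup_tree (label t) [T] = t" if "t \<in> subtrees T" for t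
    using lookup_tree_subtree[OF assms(1) _ that] by simp
  then have "(THE t. t \<in> subtrees T \<and> label t = l) = lookup_tree l [T]"
    using s by (intro the_equality) metis+
  then show ?thesis by (simp add: num_children_def)
qed

lemma forest_labels_walk_insert [simp]:
  "forest_labels (walk_insert x ts) = insert x (forest_labels ts)"
  by (induction x ts rule: walk_insert.induct) auto

lemma search_forest_walk_insert:
  "search_forest ts \<Longrightarrow> x \<notin> forest_labels ts \<Longrightarrow> search_forest (walk_insert x ts)"
  by (induction x ts rule: walk_insert.induct) auto

text \<open>The new node becomes a root iff the walk never descends, that is, iff \<open>x\<close>
  exceeds all roots and with them all labels.\<close>

lemma length_walk_insert:
  assumes "search_forest ts" "x \<notin> forest_labels ts"
  shows "length (walk_insert x ts) = length ts + (if \<forall>u\<in>forest_labels ts. u < x then 1 else 0)"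
  using assms by (induction x ts rule: walk_insert.induct) auto

text \<open>Insertion hangs \<open>x\<close> below its successor, the least label greater than
  \<open>x\<close>, if there is one.\<close>

lemma length_children_walk_insert:
  assumes "search_forest ts" "x \<notin> forest_labels ts"
  shows "length (children (lookup_tree v (walk_insert x ts))) = length (children (lookup_tree v ts)) +
    (if v \<in> forest_labels ts \<and> x < v \<and> (\<forall>u\<in>forest_labels ts. x < u \<longrightarrow> v \<le> u) then 1 else 0)"
  using assms
proof (induction x ts rule: walk_insert.induct)
  case (2 x l cs ts)
  let ?c = "\<lambda>ts. v \<in> forest_labels ts \<and> x < v \<and> (\<forall>u\<in>forest_labels ts. x < u \<longrightarrow> v \<le> u)"
  have ne: "x \<noteq> l" "x \<notin> forest_labels cs" "x \<notin> forest_labels ts"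
    and search: "search_forest cs" "search_forest ts"
    and less: "\<And>u. u \<in> forest_labels cs \<Longrightarrow> u < l" "\<And>u. u \<in> forest_labels ts \<Longrightarrow> l < u"
    using "2.prems" by auto
  show ?case
  proof (cases "x < l")
    case True
    consider "v = l" | "v < l" | "l < v" by linarith
    then show ?thesis
    proof cases
      case 1
      \<comment> \<open>\<open>l\<close> gains a child iff the walk through \<open>cs\<close> stays
        on its top level, that is, iff no label of \<open>cs\<close> lies between \<open>x\<close>
        and \<open>l\<close>.\<close>
      have "(\<forall>u\<in>forest_labels cs. u < x) \<longleftrightarrow> (\<forall>u\<in>forest_labels cs. x < u \<longrightarrow> l \<le> u)"
        using less(1) ne(2) by (metis leD linorder_neqE_nat order.asym)
      moreover have "\<forall>u\<in>forest_labels ts. l \<le> u" using less(2) by (simp add: less_imp_le)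
      ultimately have "?c (Node l cs # ts) \<longleftrightarrow> (\<forall>u\<in>forest_labels cs. u < x)"
        using 1 True by auto
      then show ?thesis using 1 True length_walk_insert[OF search(1) ne(2)] by simp
    next
      case 2
      then have "?c (Node l cs # ts) \<longleftrightarrow> ?c cs" using less by fastforce
      with 2 True "2.IH"(1)[OF True search(1) ne(2)] show ?thesis by simp
    next
      case 3
      then have "\<not> ?c (Node l cs # ts)" using True by auto
      with 3 True show ?thesis by simp
    qed
  next
    case False
    consider "v \<le> l" | "l < v" by linarith
    then show ?thesis
    proof cases
      case 1
      then have "\<not> ?c (Node l cs # ts)" using False by auto
      with 1 False show ?thesis by simp
    next
      case 2
      then have "?c (Node l cs # ts) \<longleftrightarrow> ?c ts" using False ne(1) less by fastforce
      with 2 False "2.IH"(2)[OF False search(2) ne(3)] show ?thesis by simp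
    qed
  qed
qed simp

text \<open>Adds up \<open>length_children_walk_insert\<close> over all insertions. The bound
  \<open>x < m\<close> sends every walk below the root, so the forest remains a single tree.\<close>

lemma length_children_fold_walk_insert:
  assumes "distinct xs" "\<forall>x\<in>set xs. x < m"
  shows "\<exists>T. fold walk_insert xs [Node m []] = [T] \<and> label T = m \<and> search_forest [T] \<and>
    forest_labels [T] = insert m (set xs) \<and>
    (\<forall>v. length (children (lookup_tree v [T])) =
       card {q. q < length xs \<and> v = Min {u \<in> insert m (set (take q xs)). xs ! q < u}})"
  using assms
proof (induction xs rule: rev_induct)
  case (snoc x xs)
  define ts where "ts = fold walk_insert xs [Node m []]"
  obtain T where IH: "ts = [T]" "label T = m" "search_forest ts" "forest_labels ts = insert m (set xs)"
    "\<And>v. length (children (lookup_tree v ts)) =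
       card {q. q < length xs \<and> v = Min {u \<in> insert m (set (take q xs)). xs ! q < u}}"
    using snoc by (auto simp: ts_def simp del: forest_labels.simps search_forest.simps lookup_tree.simps)
  have x: "x < m" "x \<notin> set xs" "x \<notin> forest_labels ts" using snoc.prems IH(4) by auto
  obtain T' where T': "walk_insert x ts = [T']" "label T' = m"
    using IH(1,2) x(1) by (cases T) auto
  have count: "length (children (lookup_tree v (walk_insert x ts))) =
      card {q. q < length (xs @ [x]) \<and> v = Min {u \<in> insert m (set (take q (xs @ [x]))). (xs @ [x]) ! q < u}}" for v
  proof -
    let ?A = "{q. q < length xs \<and> v = Min {u \<in> insert m (set (take q xs)). xs ! q < u}}"
    let ?P = "v = Min {u \<in> insert m (set xs). x < u}"
    have "{q. q < length (xs @ [x]) \<and> v = Min {u \<in> insert m (set (take q (xs @ [x]))). (xs @ [x]) ! q < u}}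
        = ?A \<union> (if ?P then {length xs} else {})"
      by (auto simp: nth_append less_Suc_eq split: if_splits)
    moreover have "card (?A \<union> (if ?P then {length xs} else {})) = card ?A + (if ?P then 1 else 0)"
      by (subst card_Un_disjoint) auto
    moreover have "?P \<longleftrightarrow> v \<in> forest_labels ts \<and> x < v \<and> (\<forall>u\<in>forest_labels ts. x < u \<longrightarrow> v \<le> u)"
      using x(1) by (subst eq_commute, subst Min_eq_iff) (auto simp: IH(4))
    ultimately show ?thesis
      using IH(5)[of v] length_children_walk_insert[OF IH(3) x(3), of v] by simp
  qed
  have "forest_labels [T'] = insert m (set (xs @ [x]))"
    using IH(4) T'(1) forest_labels_walk_insert[of x ts] by auto
  moreover have "fold walk_insert (xs @ [x]) [Node m []] = [T']"
    using T'(1) by (simp add: ts_def)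
  ultimately show ?case
    using T'(2) search_forest_walk_insert[OF IH(3) x(3)] count unfolding T'(1) by blast
qed auto

section \<open>Regions of a composition\<close>

lemma psum_Suc: "a < length \<alpha> \<Longrightarrow> psum \<alpha> (Suc a) = psum \<alpha> a + \<alpha> ! a"
  by (simp add: psum_def take_Suc_conv_app_nth)

lemma psum_0 [simp]: "psum \<alpha> 0 = 0"
  by (simp add: psum_def)

lemma psum_length [simp]: "psum \<alpha> (length \<alpha>) = sum_list \<alpha>"
  by (simp add: psum_def)

lemma psum_mono: "a \<le> b \<Longrightarrow> psum \<alpha> a \<le> psum \<alpha> b"
  unfolding psum_def by (metis le_add1 le_iff_add sum_list.append take_add)

lemma region_index_eqI:
  assumes "a \<in> {1..length \<alpha>}" "i \<in> region \<alpha> a"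
  shows "region_index \<alpha> i = a"
  unfolding region_index_def
proof (rule the_equality)
  fix b
  assume b: "b \<in> {1..length \<alpha>} \<and> i \<in> region \<alpha> b"
  show "b = a"
  proof (rule ccontr)
    assume "b \<noteq> a"
    then have "a \<le> b - 1 \<or> b \<le> a - 1" by linarith
    then have "psum \<alpha> a \<le> psum \<alpha> (b - 1) \<or> psum \<alpha> b \<le> psum \<alpha> (a - 1)"
      using psum_mono by blast
    with b assms show False by (auto simp: region_def)
  qed
qed (use assms in simp)

lemma region_exists:
  assumes "i \<in> {1..sum_list \<alpha>}"
  shows "\<exists>a\<in>{1..length \<alpha>}. i \<in> region \<alpha> a"
proof -
  define a where "a = (LEAST a. i \<le> psum \<alpha> a)"
  have "i \<le> psum \<alpha> (length \<alpha>)" using assms by simp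
  then have 1: "i \<le> psum \<alpha> a" "a \<le> length \<alpha>"
    unfolding a_def by (rule LeastI, rule Least_le)
  have "a \<noteq> 0" using 1(1) assms by (cases a) auto
  then have "\<not> i \<le> psum \<alpha> (a - 1)"
    unfolding a_def by (intro not_less_Least) simp
  with 1 \<open>a \<noteq> 0\<close> show ?thesis by (intro bexI[of _ a]) (auto simp: region_def)
qed

lemma region_index_mem:
  assumes "i \<in> {1..sum_list \<alpha>}"
  shows "region_index \<alpha> i \<in> {1..length \<alpha>}" "i \<in> region \<alpha> (region_index \<alpha> i)"
  using region_exists[OF assms] region_index_eqI by metis+

lemma region_index_mono:
  assumes "i \<in> {1..sum_list \<alpha>}" "j \<in> {1..sum_list \<alpha>}" "i \<le> j"
  shows "region_index \<alpha> i \<le> region_index \<alpha> j"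
proof (rule ccontr)
  assume "\<not> ?thesis"
  then have "region_index \<alpha> j \<le> region_index \<alpha> i - 1" by simp
  from psum_mono[OF this, of \<alpha>] show False
    using region_index_mem(2)[OF assms(1)] region_index_mem(2)[OF assms(2)] assms(3)
    by (simp add: region_def)
qed

section \<open>The forest of an avoiding permutation\<close>

lemma sorted_list_of_set_Un_less:
  fixes A B :: "nat set"
  assumes "finite A" "finite B" "\<And>a b. a \<in> A \<Longrightarrow> b \<in> B \<Longrightarrow> a < b"
  shows "sorted_list_of_set (A \<union> B) = sorted_list_of_set A @ sorted_list_of_set B"
proof (rule sorted_distinct_set_unique)
  show "sorted (sorted_list_of_set A @ sorted_list_of_set B)"
    using assms by (auto simp: sorted_append less_imp_le)
  show "distinct (sorted_list_of_set A @ sorted_list_of_set B)"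
    using assms by fastforce
qed (use assms in auto)

text \<open>Turns partial sums of runs into counts, so that comparing \<open>phi \<alpha> w\<close>
  with \<open>nu \<alpha>\<close> becomes comparing \<open>cls\<close> with
  \<open>opn\<close>.\<close>

lemma sum_list_card_fibres:
  assumes "finite A"
  shows "sum_list (map (\<lambda>t. card {j \<in> A. F j = t}) [0..<m]) = card {j \<in> A. F j < (m :: nat)}"
proof (induction m)
  case (Suc m)
  have "{j \<in> A. F j < Suc m} = {j \<in> A. F j < m} \<union> {j \<in> A. F j = m}" by auto
  moreover have "card ({j \<in> A. F j < m} \<union> {j \<in> A. F j = m}) =
      card {j \<in> A. F j < m} + card {j \<in> A. F j = m}"
    using assms by (intro card_Un_disjoint) auto
  ultimately show ?case using Suc by simp
qed simp

lemma concat_map_concat_map: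
  "concat (map (\<lambda>a. concat (map F (G a))) as) = concat (map F (concat (map G as)))"
  by (induction as) auto

locale avoiding_perm =
  fixes \<alpha> :: "nat list" and w :: "nat \<Rightarrow> nat"
  assumes pos: "\<forall>a\<in>set \<alpha>. a > 0"
    and avoiding: "w \<in> parabolic_231_avoiding \<alpha>"
begin

abbreviation n :: nat where "n \<equiv> sum_list \<alpha>"

abbreviation reg :: "nat \<Rightarrow> nat" where "reg \<equiv> region_index \<alpha>"

definition opn :: "nat \<Rightarrow> nat" where "opn j = psum \<alpha> (reg j)"

definition cls :: "nat \<Rightarrow> nat" where "cls j = code_entry \<alpha> w j + opn j"

definition covers :: "nat \<Rightarrow> nat set" where
  "covers q = {j \<in> {1..n}. opn j < q \<and> q \<le> cls j}"

text \<open>\<open>opn j\<close> and \<open>cls j\<close> delimit the run of smaller values after the region of \<open>j\<close> that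
  \<open>code_entry\<close> counts. The value \<open>n + 1\<close> stands for the root.\<close>

definition stack :: "nat \<Rightarrow> nat set" where
  "stack q = insert (n + 1) (w ` covers q)"

definition parent :: "nat \<Rightarrow> nat" where
  "parent q = Min (stack q)"

definition kids :: "nat \<Rightarrow> nat" where
  "kids v = card {q \<in> {1..n}. parent q = v}"

lemma w_permutes: "w permutes {1..n}"
  using avoiding by (simp add: parabolic_231_avoiding_def parabolic_perms_def)

lemma w_eq_iff [simp]: "w i = w j \<longleftrightarrow> i = j"
  using permutes_inj[OF w_permutes] by (auto dest: injD)

lemma w_mem [simp]: "w i \<in> {1..n} \<longleftrightarrow> i \<in> {1..n}"
  by (rule permutes_in_image[OF w_permutes])

lemma w_bounds: "1 \<le> i \<Longrightarrow> i \<le> n \<Longrightarrow> 1 \<le> w i \<and> w i \<le> n"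
  using w_mem[of i] by (simp del: w_mem)

lemma w_surj: "v \<in> {1..n} \<Longrightarrow> \<exists>i\<in>{1..n}. w i = v"
  using permutes_image[OF w_permutes] by (metis image_iff)

lemma opn_bounds:
  assumes "j \<in> {1..n}"
  shows "j \<le> opn j" "opn j \<le> n"
  using region_index_mem[OF assms] psum_mono[of "reg j" "length \<alpha>" \<alpha>]
  by (auto simp: opn_def region_def)

lemma reg_less_iff:
  assumes "i \<in> {1..n}" "j \<in> {1..n}"
  shows "reg i < reg j \<longleftrightarrow> opn i < j"
proof
  assume "reg i < reg j"
  then have "psum \<alpha> (reg i) \<le> psum \<alpha> (reg j - 1)" by (intro psum_mono) simp
  with region_index_mem(2)[OF assms(2)] show "opn i < j" by (simp add: opn_def region_def)
next
  assume "opn i < j"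
  then have "reg i \<noteq> reg j" using opn_bounds(1)[OF assms(2)] by (auto simp: opn_def)
  moreover have "reg i \<le> reg j"
    using \<open>opn i < j\<close> opn_bounds(1)[OF assms(1)] assms by (intro region_index_mono) auto
  ultimately show "reg i < reg j" by simp
qed

lemma opn_eq_iff:
  assumes "i \<in> {1..n}" "j \<in> {1..n}"
  shows "opn i = opn j \<longleftrightarrow> reg i = reg j"
proof
  assume "opn i = opn j"
  then show "reg i = reg j"
    using reg_less_iff[OF assms] reg_less_iff[OF assms(2,1)] opn_bounds(1)[OF assms(1)]
      opn_bounds(1)[OF assms(2)] by (metis leD linorder_neqE_nat)
qed (simp add: opn_def)

lemma w_less_in_region:
  assumes "i < j" "1 \<le> i" "j \<le> n" "reg i = reg j"
  shows "w i < w j"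
  using assms(1,3,4)
proof (induction j rule: less_induct)
  case (less j)
  obtain m where m: "j = Suc m" using less.prems by (cases j) auto
  have m': "reg m = reg j"
    using region_index_mono[of i \<alpha> m] region_index_mono[of m \<alpha> j] less.prems m assms(2) by auto
  moreover have "w m < w (m + 1)" if "reg m = reg (m + 1)"
    using avoiding that m less.prems assms(2)
    by (auto simp: parabolic_231_avoiding_def parabolic_perms_def)
  ultimately have step: "w m < w j" using m by simp
  show ?case
  proof (cases "i = m")
    case False
    then have "w i < w m" using less.IH[of m] less.prems m m' by simp
    with step show ?thesis by simp
  qed (use step in simp)
qed

text \<open>Walking through the values from \<open>w m\<close> up to \<open>w i\<close>, the position stays to the right of the
  region of \<open>j\<close>: it cannot jump across that region without creating the forbidden pattern.\<close>

lemma value_in_middle_region: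
  assumes "i \<in> {1..n}" "j \<in> {1..n}" "m \<in> {1..n}" "reg i < reg j" "reg j < reg m"
    and "w m < w i" "w i < w j"
  shows "\<exists>q\<in>{1..n}. reg q = reg j \<and> w m < w q \<and> w q < w i"
proof (rule ccontr)
  assume none: "\<not> ?thesis"
  have right: "reg p > reg j" if "p \<in> {1..n}" "w p = v" "w m \<le> v" "v \<le> w i" for p v
    using that(3,1,2,4)
  proof (induction v arbitrary: p rule: dec_induct)
    case base
    then show ?case using assms(5) by simp
  next
    case (step v)
    have "v \<in> {1..n}" using step.hyps step.prems w_bounds[of m] w_bounds[of i] assms by auto
    then obtain p' where p': "p' \<in> {1..n}" "w p' = v" using w_surj by blast
    then have *: "reg j < reg p'" using step by simp
    show ?case
    proof (rule ccontr)
      assume "\<not> reg j < reg p"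
      moreover have "reg p \<noteq> reg j"
        using none step assms(4) by (metis Suc_leD le_imp_less_Suc le_less w_eq_iff less_not_refl)
      ultimately have "reg p < reg j" by simp
      then have "p < j" "j < p'"
        using * reg_less_iff[of p j] reg_less_iff[of j p'] opn_bounds(1)[of p] opn_bounds(1)[of j]
          step.prems(1) assms(2) p'(1) by auto
      moreover have "w p < w j" using step.prems assms(7) by simp
      moreover have "w p = w p' + 1" using step.prems p' by simp
      ultimately show False
        using avoiding \<open>reg p < reg j\<close> * step.prems(1) p'(1)
        unfolding parabolic_231_avoiding_def by fastforce
    qed
  qed
  from right[OF assms(1) refl] assms(4,6) show False by simp
qed

text \<open>The first three facts hold because the maximum in \<open>code_entry\<close> is attained,
  the last one because it cannot be enlarged.\<close>

lemma
  assumes j: "j \<in> {1..n}"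
  shows opn_le_cls: "opn j \<le> cls j"
    and cls_le: "cls j \<le> n"
    and w_less_covered: "\<And>q. opn j < q \<Longrightarrow> q \<le> cls j \<Longrightarrow> w q < w j"
    and w_greater_after: "cls j < n \<Longrightarrow> w j < w (cls j + 1)"
proof -
  let ?K = "{k. opn j + k \<le> n \<and> (\<forall>t\<in>{1..k}. w j > w (opn j + t))}"
  have c: "code_entry \<alpha> w j = Max ?K" by (simp add: code_entry_def opn_def)
  have "?K \<subseteq> {..n}" by auto
  then have fin: "finite ?K" by (rule finite_subset) simp
  have "0 \<in> ?K" using opn_bounds[OF j] by simp
  then have K: "code_entry \<alpha> w j \<in> ?K" unfolding c using fin Max_in by blast
  show "opn j \<le> cls j" "cls j \<le> n" using K by (auto simp: cls_def)
  show "w q < w j" if "opn j < q" "q \<le> cls j" for q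
  proof -
    have "q - opn j \<in> {1..code_entry \<alpha> w j}" using that by (auto simp: cls_def)
    then have "w (opn j + (q - opn j)) < w j" using K by blast
    with that show ?thesis by simp
  qed
  show "w j < w (cls j + 1)" if "cls j < n"
  proof (rule ccontr)
    assume "\<not> ?thesis"
    moreover have "w (cls j + 1) \<noteq> w j"
      using opn_bounds[OF j] \<open>opn j \<le> cls j\<close> by simp
    ultimately have "w (cls j + 1) < w j" by (simp del: w_eq_iff)
    then have "Suc (code_entry \<alpha> w j) \<in> ?K"
      using K that by (auto simp: cls_def le_Suc_eq add.commute)
    then have "Suc (code_entry \<alpha> w j) \<le> code_entry \<alpha> w j"
      unfolding c using fin Max_ge by blast
    then show False by simp
  qed
qed

section \<open>Parents as least larger values to the left\<close>

lemma finite_covers [simp]: "finite (covers q)"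
  by (simp add: covers_def)

lemma finite_stack [simp]: "finite (stack q)"
  by (simp add: stack_def)

lemma parent_in_stack: "parent q \<in> stack q"
  unfolding parent_def by (rule Min_in) (auto simp: stack_def)

lemma w_less_stack:
  assumes "q \<in> {1..n}" "v \<in> stack q"
  shows "w q < v"
  using assms w_bounds[of q] by (auto simp: stack_def covers_def intro: w_less_covered)

text \<open>Let \<open>w j\<close> be the least larger value to the left of \<open>q\<close>. If the
  interval of \<open>j\<close> ended before \<open>q\<close>, the value right behind it would exceed
  \<open>w j\<close>, and \<open>value_in_middle_region\<close> would give a value between
  \<open>w q\<close> and \<open>w j\<close> to the left of \<open>q\<close>. So \<open>w j\<close>
  is on the stack; conversely, all stack entries are candidates for the minimum.\<close>

lemma parent_eq_successor:
  assumes q: "q \<in> {1..n}"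
  shows "parent q = Min {u \<in> insert (n + 1) (w ` {1..<q}). w q < u}" (is "_ = Min ?S")
proof -
  have fin: "finite ?S" by simp
  have "n + 1 \<in> ?S" using w_bounds[of q] q by auto
  then have S: "Min ?S \<in> ?S" using fin Min_in by blast
  have "Min ?S \<in> stack q"
  proof (cases "Min ?S = n + 1")
    case False
    with S obtain j where j: "j \<in> {1..n}" "j < q" "w j = Min ?S" "w q < w j" using q by auto
    have "reg j \<noteq> reg q" using w_less_in_region[of j q] j q by auto
    then have o: "opn j < q"
      using reg_less_iff[OF j(1) q] region_index_mono[OF j(1) q] j(2) by simp
    have "q \<le> cls j"
    proof (rule ccontr)
      define e where "e = cls j + 1"
      assume "\<not> ?thesis"
      then have e: "e \<in> {1..n}" "e \<le> q" "w j < w e" "opn j < e"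
        using q w_greater_after[OF j(1)] opn_le_cls[OF j(1)] by (auto simp: e_def)
      have "e \<noteq> q" using e j by auto
      \<comment> \<open>In a common region \<open>w e < w q < w j\<close> would hold, against
        \<open>w j < w e\<close>.\<close>
      then have "reg e \<noteq> reg q" using w_less_in_region[of e q] e j q by auto
      then have "reg e < reg q" using region_index_mono[OF e(1) q e(2)] by simp
      moreover have "reg j < reg e" using reg_less_iff[OF j(1) e(1)] e by simp
      ultimately obtain p where p: "p \<in> {1..n}" "reg p = reg e" "w q < w p" "w p < w j"
        using value_in_middle_region[OF j(1) e(1) q] j e by blast
      then have "p < q"
        using \<open>reg e < reg q\<close> reg_less_iff[OF p(1) q] opn_bounds(1)[OF p(1)] by simp
      then have "w p \<in> ?S" using p by auto
      then have "Min ?S \<le> w p" using fin Min_le by blast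
      with p j show False by simp
    qed
    then have "j \<in> covers q" using j o by (simp add: covers_def)
    then show ?thesis unfolding j(3)[symmetric] stack_def by blast
  qed (simp add: stack_def)
  moreover have "Min ?S \<le> v" if "v \<in> stack q" for v
  proof -
    have "v \<in> ?S" using that w_less_stack[OF q that] opn_bounds(1)
      by (fastforce simp: stack_def covers_def)
    then show ?thesis using fin Min_le by blast
  qed
  ultimately show ?thesis unfolding parent_def by (intro Min_eqI) auto
qed

lemma insertion_tree_kids:
  shows "length (children (insertion_tree \<alpha> w)) = kids (n + 1)"
    and "i \<in> {1..n} \<Longrightarrow> num_children (insertion_tree \<alpha> w) (w i) = kids (w i)"
proof -
  define xs where "xs = map w [1..<n + 1]"
  have xs: "distinct xs" "length xs = n"
    by (simp_all add: xs_def distinct_map inj_on_def del: upt_Suc)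
  have less: "\<forall>x\<in>set xs. x < n + 1"
  proof
    fix x
    assume "x \<in> set xs"
    then obtain i where "i \<in> {1..n}" "x = w i" by (auto simp: xs_def simp del: upt_Suc)
    then show "x < n + 1" using w_bounds[of i] by simp
  qed
  obtain T where T: "fold walk_insert xs [Node (n + 1) []] = [T]" "label T = n + 1"
    "search_forest [T]" "forest_labels [T] = insert (n + 1) (set xs)"
    and count: "\<And>v. length (children (lookup_tree v [T])) =
       card {q. q < length xs \<and> v = Min {u \<in> insert (n + 1) (set (take q xs)). xs ! q < u}}"
    using length_children_fold_walk_insert[OF xs(1) less] by blast
  have tree: "insertion_tree \<alpha> w = T"
    using T(1) by (simp add: insertion_tree_def xs_def del: upt_Suc)
  have kids: "length (children (lookup_tree v [T])) = kids v" for v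
  proof -
    have "{q \<in> {1..n}. parent q = v} =
      Suc ` {q. q < length xs \<and> v = Min {u \<in> insert (n + 1) (set (take q xs)). xs ! q < u}}"
      (is "_ = Suc ` ?A")
    proof -
      have eq: "v = Min {u \<in> insert (n + 1) (set (take q xs)). xs ! q < u} \<longleftrightarrow> parent (Suc q) = v"
        if "q < n" for q
      proof -
        have "set (take q xs) = w ` {1..<Suc q}" "xs ! q = w (Suc q)"
          using that by (simp_all add: xs_def take_map take_upt del: upt_Suc)
        then show ?thesis using that parent_eq_successor[of "Suc q"] by auto
      qed
      have "?A = {q. q < n \<and> parent (Suc q) = v}"
        unfolding xs(2) by (rule Collect_cong, rule conj_cong[OF refl], rule eq)
      moreover have "{q \<in> {1..n}. parent q = v} = Suc ` {q. q < n \<and> parent (Suc q) = v}"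
      proof (intro equalityI subsetI)
        fix q
        assume "q \<in> {q \<in> {1..n}. parent q = v}"
        then show "q \<in> Suc ` {q. q < n \<and> parent (Suc q) = v}"
          by (intro image_eqI[of _ _ "q - 1"]) auto
      qed auto
      ultimately show ?thesis by simp
    qed
    then show ?thesis using count[of v] by (simp add: kids_def card_image)
  qed
  have "lookup_tree (n + 1) [T] = T" using T(2) by (cases T) auto
  then show "length (children (insertion_tree \<alpha> w)) = kids (n + 1)"
    using kids[of "n + 1"] by (simp add: tree)
  show "num_children (insertion_tree \<alpha> w) (w i) = kids (w i)" if "i \<in> {1..n}"
  proof -
    have "w i \<in> forest_labels [T]" using that T(4) by (simp add: xs_def del: upt_Suc)
    then show ?thesis using num_children_lookup[OF T(3)] kids by (simp add: tree)
  qed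
qed

section \<open>The sweep over the positions and its parse\<close>

definition opened_at :: "nat \<Rightarrow> nat set" where
  "opened_at t = w ` {j \<in> {1..n}. opn j = t}"

definition closed_at :: "nat \<Rightarrow> nat set" where
  "closed_at t = w ` {j \<in> {1..n}. cls j = t}"

text \<open>Each position \<open>t\<close> enters the elements of the region ending at \<open>t\<close>, largest value first, then
  visits a leaf marking \<open>t\<close> and finally leaves the elements with \<open>cls j = t\<close>. An element has one
  child more than in the insertion tree: the next smaller element of its region or, for the
  smallest, the leaf at the end of the region.\<close>

definition steps :: "nat \<Rightarrow> nat option list" where
  "steps t = map (\<lambda>v. Some (Suc (kids v))) (rev (sorted_list_of_set (opened_at t))) @
     Some 0 # None # replicate (card (closed_at t)) None"

text \<open>For \<open>v\<close> on the stack, this is the counter that \<open>parses\<close> holds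
  just before \<open>steps t\<close> is read.\<close>

definition later_kids :: "nat \<Rightarrow> nat \<Rightarrow> nat" where
  "later_kids t v = card {q \<in> {t..n}. parent q = v}"

lemma later_kids_Suc:
  assumes "t \<in> {1..n}"
  shows "later_kids t v = later_kids (Suc t) v + (if v = parent t then 1 else 0)"
proof -
  have "{t..n} = insert t {Suc t..n}" using assms by auto
  then have "{q \<in> {t..n}. parent q = v} =
      (if v = parent t then insert t {q \<in> {Suc t..n}. parent q = v} else {q \<in> {Suc t..n}. parent q = v})"
    by auto
  then show ?thesis by (simp add: later_kids_def)
qed

lemma parent_eq_w:
  assumes "j \<in> {1..n}" "parent q = w j"
  shows "opn j < q" "q \<le> cls j"
proof -
  have "w j \<noteq> n + 1" using w_bounds[of j] assms(1) by auto
  then have "w j \<in> w ` covers q"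
    using parent_in_stack[of q] assms(2) by (auto simp: stack_def)
  then show "opn j < q" "q \<le> cls j" by (auto simp: covers_def)
qed

text \<open>Besides the root, both sides hold the values \<open>w j\<close> with
  \<open>opn j \<le> t\<close> and \<open>t \<le> cls j\<close>. An empty interval opens and closes
  at the same position.\<close>

lemma stack_step:
  assumes "t \<in> {1..n}"
  shows "opened_at t \<union> stack t = closed_at t \<union> stack (Suc t)"
proof -
  have "opn j = t \<or> (opn j < t \<and> t \<le> cls j) \<longleftrightarrow> cls j = t \<or> (opn j < Suc t \<and> Suc t \<le> cls j)"
    if "j \<in> {1..n}" for j
    using opn_le_cls[OF that] by auto
  then have "{j \<in> {1..n}. opn j = t} \<union> covers t = {j \<in> {1..n}. cls j = t} \<union> covers (Suc t)"
    unfolding covers_def by blast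
  then show ?thesis
    by (simp add: opened_at_def closed_at_def stack_def image_Un[symmetric])
qed

lemma finite_opened_at [simp]: "finite (opened_at t)" and finite_closed_at [simp]: "finite (closed_at t)"
  by (simp_all add: opened_at_def closed_at_def)

text \<open>If anything opens at \<open>t\<close>, then \<open>t\<close> ends its region, so
  \<open>w t\<close> is the largest value entering, and it lies below the stack. New nodes thus nest
  inside the old ones.\<close>

lemma opened_at_less_stack:
  assumes "t \<in> {1..n}" "u \<in> opened_at t" "v \<in> stack t"
  shows "u < v"
proof -
  obtain j where j: "j \<in> {1..n}" "opn j = t" "u = w j" using assms(2) by (auto simp: opened_at_def)
  have "w j \<le> w t"
  proof (cases "j = t")
    case False
    moreover have "reg t = reg j"
      using reg_less_iff[OF j(1) assms(1)] region_index_mono[OF j(1) assms(1)]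
        opn_bounds(1)[OF j(1)] j(2) by simp
    ultimately show ?thesis
      using w_less_in_region[of j t] opn_bounds(1)[OF j(1)] j assms(1) by simp
  qed simp
  then show ?thesis using w_less_stack[OF assms(1,3)] j(3) by simp
qed

text \<open>Closing values lie below \<open>w (t + 1)\<close>, which lies below the entries that
  remain; for \<open>t = n\<close> only the root remains. So the closing nodes are the innermost
  ones.\<close>

lemma closed_at_less_stack:
  assumes "u \<in> closed_at t" "v \<in> stack (Suc t)"
  shows "u < v"
proof -
  obtain j where j: "j \<in> {1..n}" "cls j = t" "u = w j" using assms(1) by (auto simp: closed_at_def)
  show ?thesis
  proof (cases "v = n + 1")
    case True
    then show ?thesis using j w_bounds[of j] by auto
  next
    case False
    then obtain i where "i \<in> covers (Suc t)" "v = w i" using assms(2) by (auto simp: stack_def)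
    then have "Suc t \<le> n" using cls_le[of i] by (auto simp: covers_def)
    then show ?thesis
      using w_less_stack[of "Suc t" v] w_greater_after[OF j(1)] assms(2) j by auto
  qed
qed

lemma sorted_stack_Cons:
  "\<exists>vs. sorted_list_of_set (stack t) = parent t # vs \<and> parent t \<notin> set vs"
proof -
  have "stack t \<noteq> {}" by (simp add: stack_def)
  then have "sorted_list_of_set (stack t) = parent t # sorted_list_of_set (stack t - {parent t})"
    unfolding parent_def by (intro sorted_list_of_set_nonempty) simp_all
  then show ?thesis by auto
qed

text \<open>The parser's stack consists of the open intervals sorted by value. The induction goes
  down from \<open>t = n + 1\<close>, where only the root is left, with no child to come.\<close>

lemma parses_steps:
  assumes "t \<in> {1..n + 1}"
  shows "parses (map (later_kids t) (sorted_list_of_set (stack t))) (concat (map steps [t..<n + 1]))"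
  using assms
proof (induction "n + 1 - t" arbitrary: t)
  case 0
  then have t: "t = n + 1" by simp
  have "covers t = {}" using cls_le by (fastforce simp: covers_def t)
  then show ?case by (simp add: t stack_def later_kids_def)
next
  case (Suc d)
  then have t: "t \<in> {1..n}" by auto
  let ?rest = "concat (map steps [Suc t..<n + 1])"
  obtain vs where vs: "sorted_list_of_set (stack t) = parent t # vs" "parent t \<notin> set vs"
    using sorted_stack_Cons by blast
  \<comment> \<open>Position \<open>t\<close> uses up one child of the innermost open node,
    \<open>parent t\<close>.\<close>
  have stack: "map (later_kids t) (sorted_list_of_set (stack t)) =
      Suc (later_kids (Suc t) (parent t)) # map (later_kids (Suc t)) vs"
    using vs by (auto simp: later_kids_Suc[OF t])
  \<comment> \<open>A node opened at \<open>t\<close> has all its children after \<open>t\<close>;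
    one closed at \<open>t\<close> has none left.\<close>
  have open_kids: "kids v = later_kids (Suc t) v" if v: "v \<in> opened_at t" for v
  proof -
    obtain j where j: "j \<in> {1..n}" "opn j = t" "v = w j" using v unfolding opened_at_def by blast
    have "q \<in> {1..n} \<and> parent q = v \<longleftrightarrow> q \<in> {Suc t..n} \<and> parent q = v" for q
      using parent_eq_w(1)[OF j(1), of q] j(2,3) by auto
    then show ?thesis by (simp add: kids_def later_kids_def)
  qed
  have closed_kids: "later_kids (Suc t) v = 0" if v: "v \<in> closed_at t" for v
  proof -
    obtain j where j: "j \<in> {1..n}" "cls j = t" "v = w j" using v unfolding closed_at_def by blast
    have "{q \<in> {Suc t..n}. parent q = v} = {}"
      using parent_eq_w(2)[OF j(1)] j(2,3) by fastforce
    then show ?thesis by (simp add: later_kids_def)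
  qed
  \<comment> \<open>Opening prepends to the stack and closing removes an initial segment: one sorted
    set is read in two ways.\<close>
  have "sorted_list_of_set (opened_at t) @ sorted_list_of_set (stack t) =
      sorted_list_of_set (opened_at t \<union> stack t)"
    by (rule sorted_list_of_set_Un_less[symmetric]) (auto intro: opened_at_less_stack[OF t])
  also have "\<dots> = sorted_list_of_set (closed_at t) @ sorted_list_of_set (stack (Suc t))"
    unfolding stack_step[OF t] by (rule sorted_list_of_set_Un_less) (auto intro: closed_at_less_stack)
  finally have lists: "sorted_list_of_set (opened_at t) @ parent t # vs =
      sorted_list_of_set (closed_at t) @ sorted_list_of_set (stack (Suc t))"
    by (simp add: vs)
  have opened: "map (\<lambda>v. Some (Suc (kids v))) (rev (sorted_list_of_set (opened_at t))) =
      map (\<lambda>k. Some (Suc k)) (rev (map (later_kids (Suc t)) (sorted_list_of_set (opened_at t))))"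
    by (simp add: rev_map open_kids)
  have closed: "map (later_kids (Suc t)) (sorted_list_of_set (closed_at t)) =
      replicate (card (closed_at t)) 0"
    by (rule map_eq_replicateI) (simp_all add: closed_kids)
  obtain us where us: "sorted_list_of_set (stack (Suc t)) = parent (Suc t) # us"
    using sorted_stack_Cons by blast
  have "parses (map (later_kids t) (sorted_list_of_set (stack t))) (concat (map steps [t..<n + 1])) =
      parses (Suc (later_kids (Suc t) (parent t)) # map (later_kids (Suc t)) vs) (steps t @ ?rest)"
    using t by (simp add: stack upt_rec[of t] del: upt_Suc)
  also have "\<dots> = parses (map (later_kids (Suc t)) (sorted_list_of_set (opened_at t) @ parent t # vs))
      (replicate (card (closed_at t)) None @ ?rest)"
    by (simp add: steps_def opened parses_push)
  also have "\<dots> = parses (map (later_kids (Suc t)) (sorted_list_of_set (stack (Suc t)))) ?rest"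
    unfolding lists by (simp add: closed us parses_pop)
  finally show ?case using Suc by simp
qed

text \<open>Nothing opens or closes at position \<open>0\<close>; its leaf is the one additional
  child of the virtual root.\<close>

lemma parses_all_steps: "parses [Suc (kids (n + 1))] (concat (map steps [0..<n + 1]))"
proof -
  have "opn j \<ge> 1" "cls j \<ge> 1" if "j \<in> {1..n}" for j
    using opn_bounds(1)[OF that] opn_le_cls[OF that] that by auto
  then have "opened_at 0 = {}" "closed_at 0 = {}" "covers 1 = {}"
    by (fastforce simp: opened_at_def closed_at_def covers_def)+
  then show ?thesis
    using parses_steps[of 1]
    by (simp add: upt_conv_Cons steps_def stack_def later_kids_def kids_def del: upt_Suc)
qed

section \<open>Reading off the two paths\<close>

definition region_list :: "nat \<Rightarrow> nat list" where
  "region_list a = [psum \<alpha> (a - 1) + 1..<psum \<alpha> a + 1]"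

lemma psum_step:
  assumes "a \<in> {1..length \<alpha>}"
  shows "psum \<alpha> a = psum \<alpha> (a - 1) + \<alpha> ! (a - 1)" "\<alpha> ! (a - 1) > 0"
  using psum_Suc[of "a - 1" \<alpha>] assms pos by auto

lemma length_region_list: "a \<in> {1..length \<alpha>} \<Longrightarrow> length (region_list a) = \<alpha> ! (a - 1)"
  using psum_step(1) by (simp add: region_list_def del: upt_Suc)

lemma set_region_list: "set (region_list a) = region \<alpha> a"
  by (auto simp: region_list_def region_def simp del: upt_Suc)

lemma region_subset:
  assumes "a \<in> {1..length \<alpha>}"
  shows "region \<alpha> a \<subseteq> {1..n}"
  using assms psum_mono[of a "length \<alpha>" \<alpha>] by (auto simp: region_def)

lemma concat_region_lists:
  "m \<le> length \<alpha> \<Longrightarrow> concat (map region_list [1..<m + 1]) = [1..<psum \<alpha> m + 1]"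
proof (induction m)
  case (Suc m)
  have "concat (map region_list [1..<Suc m + 1]) =
      concat (map region_list [1..<m + 1]) @ region_list (Suc m)"
    by simp
  also have "\<dots> = [1..<psum \<alpha> m + 1] @ [psum \<alpha> m + 1..<psum \<alpha> (Suc m) + 1]"
  proof -
    have "region_list (Suc m) = [psum \<alpha> m + 1..<psum \<alpha> (Suc m) + 1]"
      by (simp only: region_list_def diff_Suc_1)
    with Suc show ?thesis by (simp del: upt_Suc)
  qed
  also have "\<dots> = [1..<psum \<alpha> (Suc m) + 1]"
    using psum_mono[of m "Suc m" \<alpha>] upt_add_eq_append[of 1 "psum \<alpha> m + 1" "psum \<alpha> (Suc m) - psum \<alpha> m"]
    by simp
  finally show ?case .
qed simp

lemma positions_eq: "[0..<n + 1] = 0 # concat (map region_list [1..<length \<alpha> + 1])"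
  using concat_region_lists[of "length \<alpha>"] by (simp add: upt_conv_Cons del: upt_Suc)

lemma opn_region:
  assumes "a \<in> {1..length \<alpha>}" "j \<in> region \<alpha> a"
  shows "opn j = psum \<alpha> a"
  using region_index_eqI[OF assms] by (simp add: opn_def)

section \<open>Intervals opening at a given position\<close>

lemma opened_at_0: "opened_at 0 = {}"
  using opn_bounds(1) by (fastforce simp: opened_at_def)

lemma opened_at_inner:
  assumes "t \<in> {1..n}" "t \<noteq> opn t"
  shows "opened_at t = {}"
proof -
  have "opn j \<noteq> t" if j: "j \<in> {1..n}" for j
  proof
    assume *: "opn j = t"
    then have "j \<le> t" "\<not> reg j < reg t"
      using opn_bounds(1)[OF j] reg_less_iff[OF j assms(1)] by auto
    with region_index_mono[OF j assms(1)] have "reg j = reg t" by simp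
    with * assms(2) show False by (simp add: opn_def)
  qed
  then show ?thesis by (auto simp: opened_at_def)
qed

lemma opened_at_psum:
  assumes a: "a \<in> {1..length \<alpha>}"
  shows "opened_at (psum \<alpha> a) = w ` region \<alpha> a"
proof -
  have "psum \<alpha> a \<in> region \<alpha> a" using psum_step[OF a] by (simp add: region_def)
  have "j \<in> region \<alpha> a" if j: "j \<in> {1..n}" "opn j = psum \<alpha> a" for j
  proof -
    have p: "psum \<alpha> a \<in> {1..n}" "opn (psum \<alpha> a) = psum \<alpha> a"
      using \<open>psum \<alpha> a \<in> region \<alpha> a\<close> region_subset[OF a] opn_region[OF a] by auto
    then have "reg j = reg (psum \<alpha> a)" using opn_eq_iff[OF j(1) p(1)] j(2) by simp
    also have "\<dots> = a" using \<open>psum \<alpha> a \<in> region \<alpha> a\<close> region_index_eqI[OF a] by simp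
    finally show ?thesis using region_index_mem(2)[OF j(1)] by simp
  qed
  then have "{j \<in> {1..n}. opn j = psum \<alpha> a} = region \<alpha> a"
    using opn_region[OF a] region_subset[OF a] by blast
  then show ?thesis by (simp add: opened_at_def)
qed

text \<open>\<open>w\<close> increases on a region, so sorting by value keeps the order of
  positions.\<close>

lemma sorted_opened_at_psum:
  assumes a: "a \<in> {1..length \<alpha>}"
  shows "sorted_list_of_set (opened_at (psum \<alpha> a)) = map w (region_list a)"
proof (rule sorted_distinct_set_unique)
  have "sorted_wrt (\<lambda>i j. w i \<le> w j) (region_list a)"
  proof (rule sorted_wrt_mono_rel)
    show "sorted_wrt (<) (region_list a)" unfolding region_list_def by (rule sorted_wrt_upt)
  next
    fix i j
    assume ij: "i \<in> set (region_list a)" "j \<in> set (region_list a)" "i < j"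
    then have "i \<in> region \<alpha> a" "j \<in> region \<alpha> a" by (simp_all add: set_region_list)
    moreover from this have "reg i = reg j" using region_index_eqI[OF a] by simp
    moreover have "1 \<le> i" "j \<le> n" using region_subset[OF a] calculation by auto
    ultimately show "w i \<le> w j" using w_less_in_region ij(3) by (simp add: less_imp_le)
  qed
  then show "sorted (map w (region_list a))" by (simp add: sorted_wrt_map)
  show "distinct (map w (region_list a))"
    by (simp add: distinct_map inj_on_def region_list_def del: upt_Suc)
qed (simp_all add: opened_at_psum[OF a] set_region_list region_def)

lemma region_list_snoc:
  assumes "a \<in> {1..length \<alpha>}"
  shows "region_list a = [psum \<alpha> (a - 1) + 1..<psum \<alpha> a] @ [psum \<alpha> a]"
  using psum_step[OF assms] by (simp add: region_list_def)

lemma opened_at_inner_region: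
  assumes a: "a \<in> {1..length \<alpha>}" and t: "t \<in> set [psum \<alpha> (a - 1) + 1..<psum \<alpha> a]"
  shows "opened_at t = {}"
proof -
  have "t \<in> region \<alpha> a" using t by (simp add: region_def)
  then show ?thesis
    using opened_at_inner region_subset[OF a] opn_region[OF a] t by fastforce
qed

text \<open>Intervals open only at ends of regions, and there the whole region opens at
  once.\<close>

lemma nu_runs_eq: "nu_runs \<alpha> = map (\<lambda>t. card (opened_at t)) [0..<n + 1]"
proof -
  have block: "map (\<lambda>t. card (opened_at t)) (region_list a) = replicate (\<alpha> ! (a - 1) - 1) 0 @ [\<alpha> ! (a - 1)]"
    if a: "a \<in> {1..length \<alpha>}" for a
  proof -
    have "card (opened_at (psum \<alpha> a)) = \<alpha> ! (a - 1)"
      by (metis sorted_opened_at_psum[OF a] length_map length_sorted_list_of_set length_region_list[OF a])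
    moreover have "map (\<lambda>t. card (opened_at t)) [psum \<alpha> (a - 1) + 1..<psum \<alpha> a] =
        replicate (\<alpha> ! (a - 1) - 1) 0"
      using psum_step(1)[OF a] opened_at_inner_region[OF a]
      by (intro map_eq_replicateI) simp_all
    ultimately show ?thesis by (simp add: region_list_snoc[OF a])
  qed
  have "map (\<lambda>a. map (\<lambda>t. card (opened_at t)) (region_list a)) [1..<length \<alpha> + 1] =
      map (\<lambda>a. replicate (\<alpha> ! (a - 1) - 1) 0 @ [\<alpha> ! (a - 1)]) [1..<length \<alpha> + 1]"
    by (intro map_cong refl block) (simp del: upt_Suc)
  then have "map (\<lambda>t. card (opened_at t)) [0..<n + 1] =
      0 # concat (map (\<lambda>a. replicate (\<alpha> ! (a - 1) - 1) 0 @ [\<alpha> ! (a - 1)]) [1..<length \<alpha> + 1])"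
    by (simp only: positions_eq list.map map_concat map_map comp_def opened_at_0 card.empty)
  also have "map (\<lambda>a. replicate (\<alpha> ! (a - 1) - 1) 0 @ [\<alpha> ! (a - 1)]) [1..<length \<alpha> + 1] =
      map (\<lambda>b. replicate (b - 1) 0 @ [b]) \<alpha>"
    by (rule nth_equalityI) (simp_all del: upt_Suc)
  finally show ?thesis by (simp add: nu_runs_def)
qed

lemma card_opened_at: "card (opened_at t) = card {j \<in> {1..n}. opn j = t}"
  and card_closed_at: "card (closed_at t) = card {j \<in> {1..n}. cls j = t}"
  unfolding opened_at_def closed_at_def by (simp_all add: card_image inj_on_def)

lemma east_runs_phi: "east_runs (phi \<alpha> w) = map (\<lambda>t. card (closed_at t)) [0..<n + 1]"
  unfolding phi_def card_closed_at cls_def opn_def by (rule east_runs_path_of_runs) simp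

text \<open>No interval closes before it opens. This puts the pair into \<open>path_pairs\<close>,
  where \<open>Conj'\<close> inverts \<open>Dyck\<close>.\<close>

lemma phi_above_nu: "phi \<alpha> w \<in> paths_above (nu \<alpha>)"
proof (rule paths_aboveI)
  note runs = east_runs_phi east_runs_nu[OF pos] nu_runs_eq card_opened_at card_closed_at
  show "length (east_runs (phi \<alpha> w)) = length (east_runs (nu \<alpha>))"
    by (simp add: runs)
  have all: "{j \<in> {1..n}. opn j < n + 1} = {1..n}" "{j \<in> {1..n}. cls j < n + 1} = {1..n}"
    using opn_bounds(2) cls_le by (auto simp: less_Suc_eq_le)
  show "sum_list (east_runs (phi \<alpha> w)) = sum_list (east_runs (nu \<alpha>))"
    unfolding runs by (simp only: sum_list_card_fibres finite_atLeastAtMost all)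
  show "sum_list (take (Suc y) (east_runs (phi \<alpha> w))) \<le> sum_list (take (Suc y) (east_runs (nu \<alpha>)))" for y
  proof -
    have take: "take (Suc y) (map F [0..<n + 1]) = map F [0..<min (Suc y) (n + 1)]" for F :: "nat \<Rightarrow> nat"
      by (simp add: take_map take_upt min_def del: upt_Suc)
    have "card {j \<in> {1..n}. cls j < min (Suc y) (n + 1)} \<le> card {j \<in> {1..n}. opn j < min (Suc y) (n + 1)}"
      using opn_le_cls by (intro card_mono) (auto intro: order.strict_trans1)
    then show ?thesis
      unfolding runs take by (simp only: sum_list_card_fibres finite_atLeastAtMost)
  qed
qed

text \<open>The leaf in \<open>steps t\<close> supplies the extra up step and down step that
  \<open>Dyck\<close> adds to the runs.\<close>

lemma Dyck_nu_phi: "Dyck (nu \<alpha>, phi \<alpha> w) = dyck_word (concat (map steps [0..<n + 1]))"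
proof -
  have [simp]: "dyck_word (map (\<lambda>v. Some (F v)) vs) = replicate (length vs) Up" for F and vs :: "nat list"
    by (induction vs) auto
  have "dyck_word (concat (map steps ts)) =
      dyck_of_runs (map (\<lambda>t. card (opened_at t)) ts) (map (\<lambda>t. card (closed_at t)) ts)" for ts
    by (induction ts) (simp_all add: steps_def replicate_app_Cons_same)
  then show ?thesis
    by (simp only: Dyck_eq east_runs_phi east_runs_nu[OF pos] nu_runs_eq)
qed

text \<open>\<open>Theta\<close> reads each region from right to left, so after \<open>Flip\<close>
  the regions are reversed but the positions inside each of them increase.\<close>

lemma Flip_Theta:
  "Flip (Theta \<alpha> w) = path_of_runs
     (concat (map (\<lambda>a. map (\<lambda>i. kids (w i)) (region_list a)) (rev [1..<length \<alpha> + 1])) @ [kids (n + 1)])"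
proof -
  let ?is = "concat (map (\<lambda>a. rev (region_list a)) [1..<length \<alpha> + 1])"
  let ?step = "\<lambda>i. East # replicate (kids (w i)) North"
  have "concat (map (\<lambda>i. East # replicate (num_children (insertion_tree \<alpha> w) (w i)) North) (rev (region_list a))) =
      concat (map ?step (rev (region_list a)))" if "a \<in> {1..length \<alpha>}" for a
    using insertion_tree_kids(2) region_subset[OF that]
    by (intro arg_cong[of _ _ concat] map_cong) (auto simp: set_region_list)
  then have "map (\<lambda>a. concat (map (\<lambda>i. East # replicate (num_children (insertion_tree \<alpha> w) (w i)) North)
        (rev (region_list a)))) [1..<length \<alpha> + 1] =
      map (\<lambda>a. concat (map ?step (rev (region_list a)))) [1..<length \<alpha> + 1]"
    by (intro map_cong refl) (simp del: upt_Suc)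
  then have "Theta \<alpha> w = replicate (kids (n + 1)) North @
      concat (map (\<lambda>a. concat (map ?step (rev (region_list a)))) [1..<length \<alpha> + 1])"
    by (simp only: Theta_def Let_def insertion_tree_kids(1) flip: region_list_def)
  also have "\<dots> = replicate (kids (n + 1)) North @ concat (map ?step ?is)"
    by (simp only: concat_map_concat_map)
  finally show ?thesis
    by (simp only: Flip_north_runs) (simp add: rev_map map_concat rev_concat comp_def del: upt_Suc)
qed

text \<open>Both words go through the regions from last to first, with \<open>Suc (kids v)\<close>
  down steps and an up step for each value \<open>v\<close>; the other up steps, those of the
  leaves, only have to be regrouped.\<close>

lemma Dyck_Flip:
  "Dyck (Flip (nu \<alpha>), Flip (Theta \<alpha> w)) =
   degree_word (concat (map steps [0..<n + 1])) @ replicate (Suc (kids (n + 1))) Down"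
proof -
  let ?as = "rev [1..<length \<alpha> + 1]"
  let ?b = "\<lambda>a. \<alpha> ! (a - 1)"
  let ?h = "\<lambda>a. map (\<lambda>i. kids (w i)) (region_list a)"
  let ?F = "\<lambda>a. concat (map (\<lambda>k. replicate (Suc k) Down @ [Up]) (?h a))"
  have as: "a \<in> {1..length \<alpha>}" if "a \<in> set ?as" for a
    using that by (simp del: upt_Suc)
  \<comment> \<open>The leaf of position \<open>0\<close> is the final \<open>[Up]\<close> in
    \<open>concat_Up_shift\<close>.\<close>
  have zero: "degree_word (steps 0) = [Up]" by (simp add: steps_def opened_at_0)
  have "map (\<lambda>a. replicate (?b a - 1) 0 @ [?b a]) [1..<length \<alpha> + 1] =
      map (\<lambda>b. replicate (b - 1) 0 @ [b]) \<alpha>"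
    by (rule nth_equalityI) (simp_all del: upt_Suc)
  then have nu: "nu_runs (rev \<alpha>) = 0 # concat (map (\<lambda>a. replicate (?b a - 1) 0 @ [?b a]) ?as)"
    by (simp only: nu_runs_def flip: rev_map)
  have "east_runs (nu (rev \<alpha>)) = nu_runs (rev \<alpha>)" using pos by (intro east_runs_nu) simp
  then have "Dyck (Flip (nu \<alpha>), Flip (Theta \<alpha> w)) =
      dyck_of_runs (nu_runs (rev \<alpha>)) (concat (map ?h ?as) @ [kids (n + 1)])"
    unfolding Dyck_eq Flip_nu Flip_Theta by (subst east_runs_path_of_runs) simp_all
  also have "\<dots> = Up # concat (map (\<lambda>a. ?F a @ replicate (?b a) Up) ?as) @ replicate (Suc (kids (n + 1))) Down"
    unfolding nu using as length_region_list psum_step(2) by (subst dyck_of_runs_blocks) auto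
  also have "\<dots> = (concat (map (\<lambda>a. Up # ?F a @ replicate (?b a - 1) Up) ?as) @ [Up]) @
      replicate (Suc (kids (n + 1))) Down"
    using as psum_step(2) by (subst concat_Up_shift) auto
  also have "map (\<lambda>a. Up # ?F a @ replicate (?b a - 1) Up) ?as =
      map (\<lambda>a. degree_word (concat (map steps (region_list a)))) ?as"
  proof (intro map_cong refl)
    fix a
    assume "a \<in> set ?as"
    then have a: "a \<in> {1..length \<alpha>}" by (rule as)
    \<comment> \<open>Nothing opens before the end of the region, so each of these positions
      contributes only the up step of its leaf.\<close>
    have inner: "map (\<lambda>t. degree_word (steps t)) (rev [psum \<alpha> (a - 1) + 1..<psum \<alpha> a]) =
        replicate (?b a - 1) [Up]"
      using psum_step(1)[OF a] opened_at_inner_region[OF a]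
      by (intro map_eq_replicateI) (simp_all add: steps_def)
    have "concat (replicate m [Up]) = replicate m Up" for m by (induction m) auto
    moreover have "degree_word (concat (map steps (region_list a))) =
        degree_word (steps (psum \<alpha> a)) @ concat (replicate (?b a - 1) [Up])"
      unfolding degree_word_concat_map
      unfolding region_list_snoc[OF a] rev_append map_append inner by simp
    moreover have "degree_word (steps (psum \<alpha> a)) = Up # ?F a"
      by (simp add: steps_def degree_word_map_Some sorted_opened_at_psum[OF a] comp_def)
    ultimately show "Up # ?F a @ replicate (?b a - 1) Up = degree_word (concat (map steps (region_list a)))"
      by simp
  qed
  also have "concat \<dots> @ [Up] = degree_word (concat (map steps [0..<n + 1]))"
    by (simp only: positions_eq list.map concat.simps degree_word_simps(4) zero
        degree_word_concat_map[of "\<lambda>a. concat (map steps (region_list a))", symmetric] concat_map_concat_map)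
  finally show ?thesis .
qed

end

theorem theorem6p10:
  fixes \<alpha> :: "nat list" and n :: nat and w :: "nat \<Rightarrow> nat"
  assumes "n > 0"
    and "is_composition \<alpha> n"
    and "w \<in> parabolic_231_avoiding \<alpha>"
  shows "(nu \<alpha>, phi \<alpha> w) = Conj' (Flip (nu \<alpha>), Flip (Theta \<alpha> w))"
proof -
  interpret avoiding_perm \<alpha> w
    using assms(2,3) by unfold_locales (auto simp: is_composition_def)
  \<comment> \<open>\<open>parses_Conj\<close> computes \<open>Conj\<close> of the right-hand side;
    \<open>Conj_involution\<close> turns that equation around.\<close>
  have "Conj (Dyck (Flip (nu \<alpha>), Flip (Theta \<alpha> w))) = Dyck (nu \<alpha>, phi \<alpha> w)"
    using parses_Conj[OF parses_all_steps] Conj_involution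
    by (metis Dyck_Flip Dyck_nu_phi)
  moreover have "(nu \<alpha>, phi \<alpha> w) \<in> path_pairs"
    using phi_above_nu by (simp add: path_pairs_def)
  ultimately show ?thesis
    by (simp add: Conj'_def inv_into_f_f[OF inj_on_Dyck])
qed

end
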